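(* Assume that $\alpha\ge2$. For every $n\in\mathbb{N}$, every $A,B\in\mathbb{M}_n^+$ with $B>0$, and all $r,r'>0$, $$P_{\alpha,r}(A,B)\prec_{\log}P_{\alpha,r'}(A,B)\qquad\text{if } 0<r'\le\frac{\alpha}{2(\alpha-1)}\,r.$$ Hence $P_{\alpha,r}(A,B)\prec_{\log}P_{\alpha,r'}(A,B)$ for all $\alpha\ge2$ if $0<r'\le r/2$.
   Context: $\mathbb{M}_n$ is the set of $n\times n$ complex matrices, $\mathbb{M}_n^+$ the set of positive semidefinite ones, and $B>0$ means that $B$ is positive definite. For $\alpha,r>0$ and $A,B\in\mathbb{M}_n^+$ with $B>0$, $$P_{\alpha,r}(A,B):=\bigl\{B^{\frac1{2r}}(B^{-\frac1{2r}}A^{\frac1r}B^{-\frac1{2r}})^\alpha B^{\frac1{2r}}\bigr\}^r.$$ For $X,Y\in\mathbb{M}_n^+$, with eigenvalues listed in decreasing order with multiplicity, $\lambda_1(X)\ge\dots\ge\lambda_n(X)$ and similarly for $Y$, the log-majorization $X\prec_{\log}Y$ means $\prod_{i=1}^k\lambda_i(X)\le\prod_{i=1}^k\lambda_i(Y)$ for $k=1,\dots,n$, with equality for $k=n$. *)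

theory Defs
  imports "Jordan_Normal_Form.Schur_Decomposition"
begin

text \<open>The order on \<^typ>\<open>complex\<close> is the one of \<^theory>\<open>HOL-Library.Complex_Order\<close>:
  \<open>0 \<le> z\<close> means that \<open>z\<close> is real and nonnegative.\<close>

definition psd_mats :: "nat \<Rightarrow> complex mat set" where
  "psd_mats n = {A \<in> carrier_mat n n. mat_adjoint A = A \<and>
     (\<forall>v \<in> carrier_vec n. 0 \<le> (A *\<^sub>v v) \<bullet>c v)}"

definition pd_mats :: "nat \<Rightarrow> complex mat set" where
  "pd_mats n = {A \<in> carrier_mat n n. mat_adjoint A = A \<and>
     (\<forall>v \<in> carrier_vec n. v \<noteq> 0\<^sub>v n \<longrightarrow> 0 < (A *\<^sub>v v) \<bullet>c v)}"

definition unitary_mats :: "nat \<Rightarrow> complex mat set" where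
  "unitary_mats n = {U \<in> carrier_mat n n. mat_adjoint U * U = 1\<^sub>m n}"

definition real_diag :: "nat \<Rightarrow> (nat \<Rightarrow> real) \<Rightarrow> complex mat" where
  "real_diag n d = mat_diag n (\<lambda>i. complex_of_real (d i))"

text \<open>\<open>A\<^sup>p\<close> by the functional calculus: if \<open>A = U diag(d) U\<^sup>*\<close> with \<open>U\<close> unitary then
  \<open>A\<^sup>p = U diag(d\<^sup>p) U\<^sup>*\<close>, which does not depend on the choice of \<open>U\<close> and \<open>d\<close>
  (lemma \<open>mat_powr_eq\<close> below). Only nonzero exponents are meant, and positive semidefinite \<open>A\<close>
  (positive definite if \<open>p < 0\<close>); \<open>0 powr p = 0\<close> is then the usual convention.\<close>

definition mat_powr :: "complex mat \<Rightarrow> real \<Rightarrow> complex mat" where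
  "mat_powr A p = (THE X. \<exists>U \<in> unitary_mats (dim_row A). \<exists>d.
     A = U * real_diag (dim_row A) d * mat_adjoint U \<and>
     X = U * real_diag (dim_row A) (\<lambda>i. d i powr p) * mat_adjoint U)"

definition P_mat :: "real \<Rightarrow> real \<Rightarrow> complex mat \<Rightarrow> complex mat \<Rightarrow> complex mat" where
  "P_mat \<alpha> r A B =
     mat_powr
       (mat_powr B (1 / (2 * r)) *
        mat_powr (mat_powr B (- (1 / (2 * r))) * mat_powr A (1 / r) * mat_powr B (- (1 / (2 * r)))) \<alpha> *
        mat_powr B (1 / (2 * r))) r"

text \<open>The eigenvalues with multiplicity, in decreasing order. They are real for Hermitian \<open>X\<close>, so
  \<^const>\<open>Re\<close> is only a change of type there. The list is indexed from 0:
  \<open>\<lambda>\<^sub>i(X) = eigvals_desc X ! (i - 1)\<close>.\<close>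

definition eigvals_desc :: "complex mat \<Rightarrow> real list" where
  "eigvals_desc X = rev (sorted_list_of_multiset (image_mset Re (proots (char_poly X))))"

definition log_majorized :: "nat \<Rightarrow> complex mat \<Rightarrow> complex mat \<Rightarrow> bool" where
  "log_majorized n X Y \<longleftrightarrow>
     (\<forall>k \<in> {1..n}. (\<Prod>i<k. eigvals_desc X ! i) \<le> (\<Prod>i<k. eigvals_desc Y ! i)) \<and>
     (\<Prod>i<n. eigvals_desc X ! i) = (\<Prod>i<n. eigvals_desc Y ! i)"

lemma mat_adjoint_index:
  assumes "U \<in> carrier_mat n n" "i < n" "j < n"
  shows "mat_adjoint U $$ (i, j) = cnj (U $$ (j, i))"
  using assms unfolding mat_adjoint_def by (auto simp: mat_of_rows_def)

lemma mat_adjoint_carrier: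
  assumes "U \<in> carrier_mat n n"
  shows "mat_adjoint U \<in> carrier_mat n n"
  using assms unfolding mat_adjoint_def by (auto simp: mat_of_rows_def)

lemma real_diag_carrier: "real_diag n d \<in> carrier_mat n n"
  unfolding real_diag_def by simp

lemma unitary_mats_right:
  assumes "U \<in> unitary_mats n"
  shows "U * mat_adjoint U = 1\<^sub>m n"
  using assms mat_mult_left_right_inverse[of "mat_adjoint U" n U] mat_adjoint_carrier[of U n]
  unfolding unitary_mats_def by auto

lemma real_diag_intertwine:
  assumes W: "W \<in> carrier_mat n n" and eq: "W * real_diag n d = real_diag n e * W"
  shows "W * real_diag n (\<lambda>i. f (d i)) = real_diag n (\<lambda>i. f (e i)) * W"
proof (rule eq_matI)
  fix i j
  assume "i < dim_row (real_diag n (\<lambda>i. f (e i)) * W)" "j < dim_col (real_diag n (\<lambda>i. f (e i)) * W)"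
  then have ij: "i < n" "j < n" using W real_diag_carrier[of n "\<lambda>i. f (e i)"] by auto
  have *: "(W * real_diag n g) $$ (i, j) = W $$ (i, j) * g j" for g
    using W ij unfolding real_diag_def by (subst mat_diag_mult_right[OF W]) auto
  have **: "(real_diag n g * W) $$ (i, j) = g i * W $$ (i, j)" for g
    using W ij unfolding real_diag_def by (subst mat_diag_mult_left[OF W]) auto
  have "W $$ (i, j) * complex_of_real (d j) = W $$ (i, j) * complex_of_real (e i)"
    unfolding *[symmetric] eq ** by (rule mult.commute)
  then have "W $$ (i, j) = 0 \<or> d j = e i"
    unfolding mult_cancel_left of_real_eq_iff by blast
  then show "(W * real_diag n (\<lambda>i. f (d i))) $$ (i, j) = (real_diag n (\<lambda>i. f (e i)) * W) $$ (i, j)"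
    unfolding * ** by auto
qed (use W in \<open>auto simp: real_diag_def mat_diag_def\<close>)

lemma functional_calculus_unique:
  assumes U: "U \<in> unitary_mats n" and V: "V \<in> unitary_mats n"
    and eq: "U * real_diag n d * mat_adjoint U = V * real_diag n e * mat_adjoint V"
  shows "U * real_diag n (\<lambda>i. f (d i)) * mat_adjoint U = V * real_diag n (\<lambda>i. f (e i)) * mat_adjoint V"
proof -
  let ?U = "mat_adjoint U" and ?V = "mat_adjoint V"
  have c: "U \<in> carrier_mat n n" "V \<in> carrier_mat n n" "?U \<in> carrier_mat n n" "?V \<in> carrier_mat n n"
    "\<And>d. real_diag n d \<in> carrier_mat n n"
    using U V mat_adjoint_carrier real_diag_carrier unfolding unitary_mats_def by auto
  have UU: "?U * U = 1\<^sub>m n" "?V * V = 1\<^sub>m n" "U * ?U = 1\<^sub>m n" "V * ?V = 1\<^sub>m n"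
    using U V unitary_mats_right unfolding unitary_mats_def by auto
  have a: "X * Y * Z = X * (Y * Z)"
    if "X \<in> carrier_mat n n" "Y \<in> carrier_mat n n" "Z \<in> carrier_mat n n" for X Y Z :: "complex mat"
    using that by (rule assoc_mult_mat)
  have l: "X * (Y * Z) = Z" if "X * Y = 1\<^sub>m n"
    "X \<in> carrier_mat n n" "Y \<in> carrier_mat n n" "Z \<in> carrier_mat n n" for X Y Z :: "complex mat"
    using that a[of X Y Z] by simp
  have "?V * (U * real_diag n d * ?U) * U = ?V * (V * real_diag n e * ?V) * U"
    using eq by simp
  then have "(?V * U) * real_diag n d = real_diag n e * (?V * U)"
    using c UU by (simp add: a l mult_carrier_mat[of _ n n _ n] right_mult_one_mat[of _ n n])
  then have "(?V * U) * real_diag n (\<lambda>i. f (d i)) = real_diag n (\<lambda>i. f (e i)) * (?V * U)"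
    by (rule real_diag_intertwine[rotated]) (use c in simp)
  then have "V * ((?V * U) * real_diag n (\<lambda>i. f (d i))) * ?U = V * (real_diag n (\<lambda>i. f (e i)) * (?V * U)) * ?U"
    by simp
  then show ?thesis
    using c UU by (simp add: a l mult_carrier_mat[of _ n n _ n] right_mult_one_mat[of _ n n])
qed

lemma mat_powr_eq:
  assumes U: "U \<in> unitary_mats n"
  shows "mat_powr (U * real_diag n d * mat_adjoint U) p = U * real_diag n (\<lambda>i. d i powr p) * mat_adjoint U"
proof -
  have dim: "dim_row (U * real_diag n d * mat_adjoint U) = n"
    using U unfolding unitary_mats_def by auto
  show ?thesis
    unfolding mat_powr_def dim
  proof (rule the_equality, goal_cases)
    case 1
    show ?case using U by blast
  next
    case (2 X)
    then obtain V e where V: "V \<in> unitary_mats n"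
      and eq: "U * real_diag n d * mat_adjoint U = V * real_diag n e * mat_adjoint V"
      and X: "X = V * real_diag n (\<lambda>i. e i powr p) * mat_adjoint V"
      by auto
    show ?case
      unfolding X using functional_calculus_unique[OF U V eq, of "\<lambda>x. x powr p"] by simp
  qed
qed

end

theory Submission
  imports Defs
begin

text \<open>
  Let \<open>P\<^sub>r\<close> stand for \<open>P\<^sub>\<alpha>\<^sub>,\<^sub>r(A, B)\<close>. The proof first shows that \<open>\<parallel>P\<^sub>r\<parallel> \<le> \<parallel>P\<^sub>r\<^sub>'\<parallel>\<close> in the operator norm, for matrices of
  every size, and then applies this to compound matrices. The \<open>k\<close>-th compound (the exterior power)
  is multiplicative by the Cauchy-Binet formula (\<open>cauchy_binet\<close>), and it commutes with adjoints and,
  through diagonalization, with real powers. So it maps \<open>P\<^sub>r\<close> of \<open>A, B\<close> to \<open>P\<^sub>r\<close> of their compounds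
  (\<open>compound_P_mat\<close>), while the norm of the compound of a positive semidefinite matrix is the product
  of its \<open>k\<close> largest eigenvalues (\<open>opnorm_compound_iff\<close>). The norm inequality for the compounds is
  therefore the \<open>k\<close>-th inequality of the log-majorization. Equality for \<open>k = n\<close> holds as
  \<open>det P\<^sub>r = (det A)\<^sup>\<alpha> (det B)\<^bsup>1-\<alpha>\<^esup>\<close> for all \<open>r\<close> (\<open>det_P_mat\<close>).

  For the norm inequality, \<open>P\<^sub>r\<close> is homogeneous in \<open>A\<close>, so it suffices to show that
  \<open>\<parallel>P\<^sub>r\<^sub>'\<parallel> \<le> 1\<close> implies \<open>\<parallel>P\<^sub>r\<parallel> \<le> 1\<close> (\<open>P_mat_contraction_mono\<close>). The only inequality used is the one of Cordes,
  \<open>\<parallel>X Y\<parallel> \<le> 1 \<Longrightarrow> \<parallel>X\<^sup>s Y\<^sup>s\<parallel> \<le> 1\<close> for positive semidefinite \<open>X\<close>, \<open>Y\<close> and \<open>0 \<le> s \<le> 1\<close>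
  (\<open>cordes_inequality\<close>). Put \<open>\<tau> = (\<alpha> - 1)/\<alpha>\<close>, \<open>X = A\<^bsup>1/r'\<^esup>\<close>, \<open>Y = B\<^bsup>-1/r'\<^esup>\<close> and \<open>s = r'/r\<close>. One half
  (\<open>perspective_contraction_imp\<close>) derives \<open>\<parallel>X\<^bsup>1/(2\<tau>)\<^esup> Y\<^bsup>1/2\<^esup>\<parallel> \<le> 1\<close> from \<open>\<parallel>P\<^sub>r\<^sub>'\<parallel> \<le> 1\<close>; the other half
  (\<open>perspective_contraction\<close>) derives \<open>\<parallel>P\<^sub>r\<parallel> \<le> 1\<close> from \<open>\<parallel>X\<^sup>s Y\<^bsup>\<tau>s\<^esup>\<parallel> \<le> 1\<close>. The Cordes inequality with
  exponent \<open>2\<tau>s\<close> leads from the one to the other, and \<open>2\<tau>s \<le> 1\<close> is the condition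
  \<open>r' \<le> \<alpha>/(2(\<alpha> - 1)) r\<close>. The steps are phrased as bounds for norms of products, and not
  as operator inequalities like \<open>Y \<le> X\<^bsup>-1/\<tau>\<^esup>\<close>, because only nonnegative powers of \<open>X\<close> then occur and \<open>A\<close>
  may be singular.
\<close>

notation mat_adjoint ("(_\<^sup>\<dagger>)" [1000] 999)

section \<open>Adjoints and the Euclidean norm\<close>

lemma dim_adjoint [simp]: "dim_row (A\<^sup>\<dagger>) = dim_col A" "dim_col (A\<^sup>\<dagger>) = dim_row A"
  unfolding mat_adjoint_def by (auto simp: mat_of_rows_def)

lemma index_adjoint [simp]:
  assumes "i < dim_col A" "j < dim_row A"
  shows "A\<^sup>\<dagger> $$ (i, j) = cnj (A $$ (j, i))"
  using assms unfolding mat_adjoint_def by (auto simp: mat_of_rows_def)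

lemma dim_real_diag [simp]: "dim_row (real_diag n d) = n" "dim_col (real_diag n d) = n"
  using real_diag_carrier[of n d] by auto

lemma index_real_diag [simp]:
  "i < n \<Longrightarrow> j < n \<Longrightarrow> real_diag n d $$ (i, j) = (if i = j then of_real (d i) else 0)"
  unfolding real_diag_def mat_diag_def by auto

lemma adjoint_adjoint [simp]: "(A\<^sup>\<dagger>)\<^sup>\<dagger> = A" for A :: "complex mat"
  by (rule eq_matI) auto

lemma adjoint_mult:
  fixes A B :: "complex mat"
  assumes "dim_col A = dim_row B"
  shows "(A * B)\<^sup>\<dagger> = B\<^sup>\<dagger> * A\<^sup>\<dagger>"
  by (rule eq_matI) (use assms in \<open>auto simp: scalar_prod_def intro!: sum.cong\<close>)

lemma adjoint_real_diag [simp]: "(real_diag n d)\<^sup>\<dagger> = real_diag n d"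
  by (rule eq_matI) auto

text \<open>Associativity with side conditions on dimensions instead of carriers: all variables of the
  conditions occur in the equation, so it can be used as a rewrite rule. Right-nested products
  are the normal form throughout.\<close>

lemma mat_assoc:
  fixes A B C :: "complex mat"
  assumes "dim_col A = dim_row B" "dim_col B = dim_row C"
  shows "A * B * C = A * (B * C)"
  using assms by (intro assoc_mult_mat) auto

lemma mult_mat_cancel_left:
  fixes A B C :: "complex mat"
  assumes "A * B = 1\<^sub>m n" "dim_col A = dim_row B" "dim_col B = dim_row C" "dim_row C = n"
  shows "A * (B * C) = C"
  using assms mat_assoc[of A B C] left_mult_one_mat'[of C n] by simp

lemma real_diag_mult: "real_diag n d * real_diag n e = real_diag n (\<lambda>i. d i * e i)"
  unfolding real_diag_def by simp

lemma real_diag_cong: "(\<And>i. i < n \<Longrightarrow> d i = e i) \<Longrightarrow> real_diag n d = real_diag n e"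
  by (rule eq_matI) auto

lemma scalar_prod_adjoint:
  fixes A :: "complex mat"
  assumes "A \<in> carrier_mat n n" "v \<in> carrier_vec n" "w \<in> carrier_vec n"
  shows "(A *\<^sub>v v) \<bullet>c w = v \<bullet>c (A\<^sup>\<dagger> *\<^sub>v w)"
proof -
  have "(A *\<^sub>v v) \<bullet>c w = (\<Sum>i<n. \<Sum>j<n. A $$ (i, j) * v $ j * cnj (w $ i))"
    using assms by (auto simp: scalar_prod_def sum_distrib_right lessThan_atLeast0 intro!: sum.cong)
  also have "\<dots> = (\<Sum>j<n. \<Sum>i<n. A $$ (i, j) * v $ j * cnj (w $ i))"
    by (rule sum.swap)
  also have "\<dots> = v \<bullet>c (A\<^sup>\<dagger> *\<^sub>v w)"
    using assms by (auto simp: scalar_prod_def sum_distrib_left lessThan_atLeast0 intro!: sum.cong)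
  finally show ?thesis .
qed

text \<open>Squared norms keep all estimates free of square roots; \<open>opnorm_le\<close> below is the bound
  \<open>\<parallel>T\<parallel> \<le> c\<close> in this form.\<close>

definition sqnorm :: "complex vec \<Rightarrow> real" where
  "sqnorm v = Re (v \<bullet>c v)"

lemma sqnorm_sum: "v \<in> carrier_vec n \<Longrightarrow> sqnorm v = (\<Sum>i<n. (cmod (v $ i))\<^sup>2)"
  unfolding sqnorm_def
  by (auto simp: scalar_prod_def lessThan_atLeast0 cmod_power2 simp flip: power2_eq_square intro!: sum.cong)

lemma cscalar_self: "v \<bullet>c v = of_real (sqnorm v)"
  unfolding sqnorm_sum[OF carrier_vecI[OF refl]]
  by (auto simp: scalar_prod_def lessThan_atLeast0 simp flip: complex_norm_square intro!: sum.cong)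

lemma sqnorm_nonneg: "0 \<le> sqnorm v"
  unfolding sqnorm_sum[OF carrier_vecI[OF refl]] by (simp add: sum_nonneg)

lemma sqnorm_eq_0: "v \<in> carrier_vec n \<Longrightarrow> sqnorm v = 0 \<longleftrightarrow> v = 0\<^sub>v n"
  by (auto simp: sqnorm_sum sum_nonneg_eq_0_iff intro!: eq_vecI)

lemma sqnorm_smult: "sqnorm (c \<cdot>\<^sub>v v) = (cmod c)\<^sup>2 * sqnorm v"
  unfolding sqnorm_sum[OF carrier_vecI[OF refl]]
  by (simp add: norm_mult power_mult_distrib sum_distrib_left)

section \<open>Unitary diagonalization\<close>

lemma unitaryD:
  assumes "U \<in> unitary_mats n"
  shows "U \<in> carrier_mat n n" "dim_row U = n" "dim_col U = n" "U\<^sup>\<dagger> * U = 1\<^sub>m n" "U * U\<^sup>\<dagger> = 1\<^sub>m n"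
  using assms unitary_mats_right[OF assms] by (auto simp: unitary_mats_def)

lemma unitary_mult:
  assumes "U \<in> unitary_mats n" "V \<in> unitary_mats n"
  shows "U * V \<in> unitary_mats n"
  using unitaryD[OF assms(1)] unitaryD[OF assms(2)]
  by (auto simp: unitary_mats_def adjoint_mult mat_assoc mult_mat_cancel_left)

text \<open>Complete \<open>v\<close> to a basis, orthogonalize it by Gram-Schmidt (which does not change the first
  vector) and normalize.\<close>

lemma unitary_with_first_col:
  fixes v :: "complex vec"
  assumes v: "v \<in> carrier_vec n" and v0: "v \<noteq> 0\<^sub>v n"
  obtains W c where "W \<in> unitary_mats n" "col W 0 = c \<cdot>\<^sub>v v"
proof -
  interpret cof_vec_space n "TYPE(complex)" .
  define b where "b = basis_completion v"
  define ws where "ws = gram_schmidt n b"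
  have n: "n \<noteq> 0"
    using v v0 by (metis carrier_vecD eq_vecI index_zero_vec(2) not_less_zero)
  from basis_completion[OF v v0, folded b_def]
  have b: "distinct b" "\<not> lin_dep (set b)" "set b \<subseteq> carrier_vec n" "hd b = v" "length b = n"
    by auto
  obtain vs where bv: "b = v # vs" using b n by (cases b) auto
  from gram_schmidt_result[OF b(3,1,2) refl, folded ws_def]
  have ws: "set ws \<subseteq> carrier_vec n" "corthogonal ws" "length ws = n"
    by (auto simp: b)
  have "hd ws = v" using gram_schmidt_hd[OF v, of vs, folded bv] unfolding ws_def .
  then have ws0: "ws ! 0 = v" using ws n by (metis hd_conv_nth length_0_conv)
  have wsc: "ws ! i \<in> carrier_vec n" if "i < n" for i using ws that by auto
  have pos: "sqnorm (ws ! i) > 0" if "i < n" for i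
  proof -
    have "ws ! i \<bullet>c ws ! i \<noteq> 0" using ws that corthogonalD by metis
    then have "ws ! i \<noteq> 0\<^sub>v n" using wsc[OF that] by auto
    then show ?thesis using sqnorm_eq_0[OF wsc[OF that]] sqnorm_nonneg[of "ws ! i"] by auto
  qed
  define s where "s i = complex_of_real (1 / sqrt (sqnorm (ws ! i)))" for i
  define W where "W = mat n n (\<lambda>(i, j). s j * (ws ! j) $ i)"
  have col: "col W j = s j \<cdot>\<^sub>v ws ! j" if "j < n" for j
    using that wsc[OF that] by (intro eq_vecI) (auto simp: W_def)
  have "W\<^sup>\<dagger> * W = 1\<^sub>m n"
  proof (rule eq_matI)
    fix i j assume "i < dim_row (1\<^sub>m n)" "j < dim_col (1\<^sub>m n)"
    then have ij: "i < n" "j < n" by auto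
    have "(W\<^sup>\<dagger> * W) $$ (i, j) = (\<Sum>k<n. cnj (s i * (ws ! i) $ k) * (s j * (ws ! j) $ k))"
      using ij by (auto simp: W_def scalar_prod_def lessThan_atLeast0 intro!: sum.cong)
    also have "\<dots> = cnj (s i) * s j * (ws ! j \<bullet>c ws ! i)"
      using ij carrier_vecD[OF wsc[OF ij(1)]] carrier_vecD[OF wsc[OF ij(2)]]
      by (auto simp: scalar_prod_def lessThan_atLeast0 sum_distrib_left intro!: sum.cong)
    also have "\<dots> = (if i = j then 1 else 0)"
    proof (cases "i = j")
      case True
      have "ws ! j \<bullet>c ws ! j = of_real (sqnorm (ws ! j))"
        by (rule cscalar_self)
      then show ?thesis using True pos[OF ij(2)]
        by (simp add: s_def flip: of_real_mult)
    next
      case False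
      then show ?thesis using ws ij corthogonalD[of ws j i] by auto
    qed
    finally show "(W\<^sup>\<dagger> * W) $$ (i, j) = 1\<^sub>m n $$ (i, j)" using ij by simp
  qed (auto simp: W_def)
  then have "W \<in> unitary_mats n" by (simp add: unitary_mats_def W_def)
  moreover have "col W 0 = s 0 \<cdot>\<^sub>v v" using col[of 0] ws0 n by simp
  ultimately show ?thesis using that by blast
qed

text \<open>A unitary matrix whose first column is an eigenvector for \<open>e\<close> conjugates \<open>A\<close> to a matrix with
  first column \<open>(e, 0, \<dots>, 0)\<close>. That matrix is Hermitian, hence also its first row vanishes off
  the diagonal and \<open>e\<close> is real, and the induction hypothesis applies to the remaining block.
  The eigenvalues appear in the prescribed order \<open>es\<close>; the decreasing order is used later.\<close>

lemma spectral_theorem: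
  assumes "A \<in> carrier_mat n n" "A\<^sup>\<dagger> = A" "char_poly A = (\<Prod>e\<leftarrow>es. [:- e, 1:])"
  shows "\<exists>U \<in> unitary_mats n. A = U * real_diag n (\<lambda>i. Re (es ! i)) * U\<^sup>\<dagger>"
    and "\<forall>e \<in> set es. Im e = 0" and "length es = n"
proof -
  have "(\<exists>U \<in> unitary_mats n. A = U * real_diag n (\<lambda>i. Re (es ! i)) * U\<^sup>\<dagger>) \<and>
      (\<forall>e \<in> set es. Im e = 0) \<and> length es = n"
    using assms
  proof (induction es arbitrary: n A)
    case Nil
    then have "n = 0" using degree_monic_char_poly[of A n] by auto
    then show ?case using Nil
      by (auto simp: unitary_mats_def intro!: bexI[of _ A] eq_matI)
  next
    case (Cons e es)
    note A = Cons.prems(1) and herm = Cons.prems(2)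
    have deg: "degree (char_poly A) = length (e # es)"
      unfolding Cons.prems(3) by (rule degree_linear_factors)
    then have n: "n = Suc (length es)" using degree_monic_char_poly[OF A] by simp
    let ?m = "length es"
    have "eigenvalue A e" unfolding eigenvalue_root_char_poly[OF A] Cons.prems(3) by simp
    then obtain v where v: "v \<in> carrier_vec n" "v \<noteq> 0\<^sub>v n" "A *\<^sub>v v = e \<cdot>\<^sub>v v"
      using A by (auto simp: eigenvalue_def eigenvector_def)
    obtain W c where W: "W \<in> unitary_mats n" and col: "col W 0 = c \<cdot>\<^sub>v v"
      using unitary_with_first_col[OF v(1,2)] .
    note Wd = unitaryD[OF W]
    have Ad: "dim_row A = n" "dim_col A = n" using A by auto
    define A' where "A' = W\<^sup>\<dagger> * (A * W)"
    have A'c: "A' \<in> carrier_mat n n" unfolding A'_def using Wd Ad by auto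
    have A'h: "A'\<^sup>\<dagger> = A'"
      unfolding A'_def using Wd Ad by (simp add: adjoint_mult herm mat_assoc)
    have AW: "A = W * A' * W\<^sup>\<dagger>"
      unfolding A'_def using Wd Ad
      by (simp add: mat_assoc mult_mat_cancel_left[of W] right_mult_one_mat'[of A n])
    have "col A' 0 = W\<^sup>\<dagger> *\<^sub>v (A *\<^sub>v col W 0)"
      using n unfolding A'_def
      by (simp only: col_mult2[OF mat_adjoint_carrier[OF Wd(1)] mult_carrier_mat[OF A Wd(1)]]
          col_mult2[OF A Wd(1)] zero_less_Suc)
    also have "\<dots> = e \<cdot>\<^sub>v (W\<^sup>\<dagger> *\<^sub>v col W 0)"
      unfolding col using v Wd Ad A
      by (simp add: mult_mat_vec[OF A v(1)] mult_mat_vec[OF mat_adjoint_carrier[OF Wd(1)] v(1)]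
          smult_smult_assoc mult.commute)
    also have "W\<^sup>\<dagger> *\<^sub>v col W 0 = unit_vec n 0"
      using col_mult2[OF mat_adjoint_carrier[OF Wd(1)] Wd(1), of 0] n unfolding Wd(4) by simp
    finally have col0: "col A' 0 = e \<cdot>\<^sub>v unit_vec n 0" .
    have A'0: "A' $$ (i, 0) = (if i = 0 then e else 0)" if "i < n" for i
      using arg_cong[OF col0, of "\<lambda>v. v $ i"] A'c that n by (auto simp: unit_vec_def)
    have A'r: "A' $$ (0, i) = cnj (if i = 0 then e else 0)" if "i < n" for i
      using arg_cong[OF A'h, of "\<lambda>v. v $$ (0, i)"] A'c that n A'0[OF that] by auto
    have e: "cnj e = e" using A'0[of 0] A'r[of 0] n by simp
    define A3 where "A3 = mat ?m ?m (\<lambda>(i, j). A' $$ (Suc i, Suc j))"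
    have A3: "A3 \<in> carrier_mat ?m ?m" unfolding A3_def by simp
    have A3h: "A3\<^sup>\<dagger> = A3"
    proof (rule eq_matI)
      fix i j assume "i < dim_row A3" "j < dim_col A3"
      then have "i < ?m" "j < ?m" by (auto simp: A3_def)
      then show "A3\<^sup>\<dagger> $$ (i, j) = A3 $$ (i, j)"
        using arg_cong[OF A'h, of "\<lambda>v. v $$ (Suc i, Suc j)"] A'c n by (auto simp: A3_def)
    qed (auto simp: A3_def)
    let ?blk = "\<lambda>x M. four_block_mat (mat 1 1 (\<lambda>_. x)) (0\<^sub>m 1 ?m) (0\<^sub>m ?m 1) M"
    have blk: "A' = ?blk e A3"
    proof (rule eq_matI)
      fix i j assume "i < dim_row (?blk e A3)" "j < dim_col (?blk e A3)"
      then have "i < n" "j < n" using n A3 by auto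
      then show "A' $$ (i, j) = ?blk e A3 $$ (i, j)"
        using A'0 A'r n A3 by (cases i; cases j) (auto simp: A3_def)
    qed (use A'c n A3 in auto)
    have "char_poly A' = char_poly A"
    proof (rule char_poly_similar[OF similar_matI[of _ _ "W\<^sup>\<dagger>" W n]])
      show "A' = W\<^sup>\<dagger> * A * W" unfolding A'_def using Wd Ad by (simp add: mat_assoc)
    qed (use Wd A'c A in \<open>auto simp: mat_adjoint_carrier\<close>)
    also have "char_poly A' = char_poly (mat 1 1 (\<lambda>_. e)) * char_poly A3"
      unfolding blk by (rule char_poly_four_block_zeros_col) (use A3 in auto)
    also have "char_poly (mat 1 1 (\<lambda>_. e)) = [:- e, 1:]"
      by (simp add: char_poly_defs det_def sign_def)
    finally have "char_poly A3 = (\<Prod>e\<leftarrow>es. [:- e, 1:])"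
      unfolding Cons.prems(3) by (simp del: mult_pCons_left)
    from Cons.IH[OF A3 A3h this] obtain U3 where U3: "U3 \<in> unitary_mats ?m"
      and A3eq: "A3 = U3 * real_diag ?m (\<lambda>i. Re (es ! i)) * U3\<^sup>\<dagger>"
      and im: "\<forall>e \<in> set es. Im e = 0" by blast
    note U3d = unitaryD[OF U3]
    let ?F = "?blk 1 U3"
    have blk_mult: "?blk x M * ?blk y N = ?blk (x * y) (M * N)"
      if "M \<in> carrier_mat ?m ?m" "N \<in> carrier_mat ?m ?m" for x y M N
    proof (subst mult_four_block_mat[of _ 1 1 _ ?m _ ?m _ _ 1 _ ?m])
      show "four_block_mat (mat 1 1 (\<lambda>_. x) * mat 1 1 (\<lambda>_. y) + 0\<^sub>m 1 ?m * 0\<^sub>m ?m 1)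
        (mat 1 1 (\<lambda>_. x) * 0\<^sub>m 1 ?m + 0\<^sub>m 1 ?m * N) (0\<^sub>m ?m 1 * mat 1 1 (\<lambda>_. y) + M * 0\<^sub>m ?m 1)
        (0\<^sub>m ?m 1 * 0\<^sub>m 1 ?m + M * N) = ?blk (x * y) (M * N)"
        by (rule cong_four_block_mat) (use that in \<open>auto simp: scalar_prod_def\<close>)
    qed (use that in auto)
    have blk_adj: "(?blk x M)\<^sup>\<dagger> = ?blk (cnj x) (M\<^sup>\<dagger>)" if "M \<in> carrier_mat ?m ?m" for x M
      by (rule eq_matI) (use that in auto)
    have blk_diag: "real_diag n (\<lambda>i. Re ((e # es) ! i)) = ?blk e (real_diag ?m (\<lambda>i. Re (es ! i)))"
      by (rule eq_matI) (use n e in \<open>auto simp: complex_eq_iff\<close>)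
    have "?F\<^sup>\<dagger> * ?F = ?blk 1 (1\<^sub>m ?m)"
      unfolding blk_adj[OF U3d(1)] blk_mult[OF mat_adjoint_carrier[OF U3d(1)] U3d(1)] U3d(4) by simp
    also have "\<dots> = 1\<^sub>m n" by (rule eq_matI) (auto simp: n)
    finally have F: "?F \<in> unitary_mats n"
      using U3d(1) n by (auto simp: unitary_mats_def)
    have "A' = ?F * real_diag n (\<lambda>i. Re ((e # es) ! i)) * ?F\<^sup>\<dagger>"
      unfolding blk blk_diag blk_adj[OF U3d(1)] blk_mult[OF U3d(1) real_diag_carrier]
        blk_mult[OF mult_carrier_mat[OF U3d(1) real_diag_carrier] mat_adjoint_carrier[OF U3d(1)]]
      by (simp flip: A3eq)
    then have "A = (W * ?F) * real_diag n (\<lambda>i. Re ((e # es) ! i)) * (W * ?F)\<^sup>\<dagger>"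
      using unitaryD[OF F] Wd
      by (subst AW) (simp add: adjoint_mult mat_assoc)
    moreover have "W * ?F \<in> unitary_mats n" using W F by (rule unitary_mult)
    ultimately show ?case using im n e by (auto simp: complex_eq_iff)
  qed
  then show "\<exists>U \<in> unitary_mats n. A = U * real_diag n (\<lambda>i. Re (es ! i)) * U\<^sup>\<dagger>"
    and "\<forall>e \<in> set es. Im e = 0" and "length es = n" by auto
qed

lemma hermitian_diagonalization:
  assumes "A \<in> carrier_mat n n" "A\<^sup>\<dagger> = A"
  obtains U d where "U \<in> unitary_mats n" "A = U * real_diag n d * U\<^sup>\<dagger>"
proof -
  obtain es where "char_poly A = (\<Prod>e\<leftarrow>es. [:- e, 1:])" using char_poly_factorized[OF assms(1)] by blast
  from spectral_theorem(1)[OF assms this] that show ?thesis by blast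
qed

section \<open>Operator norm bounds\<close>

definition opnorm_le :: "nat \<Rightarrow> complex mat \<Rightarrow> real \<Rightarrow> bool" where
  "opnorm_le n T c \<longleftrightarrow> (\<forall>v \<in> carrier_vec n. sqnorm (T *\<^sub>v v) \<le> c\<^sup>2 * sqnorm v)"

lemma opnorm_le_mult:
  assumes "S \<in> carrier_mat n n" "T \<in> carrier_mat n n" "opnorm_le n S c" "opnorm_le n T d"
  shows "opnorm_le n (S * T) (c * d)"
  unfolding opnorm_le_def
proof
  fix v :: "complex vec" assume v: "v \<in> carrier_vec n"
  have "sqnorm ((S * T) *\<^sub>v v) = sqnorm (S *\<^sub>v (T *\<^sub>v v))" using assms v by simp
  also have "\<dots> \<le> c\<^sup>2 * sqnorm (T *\<^sub>v v)" using assms v by (simp add: opnorm_le_def)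
  also have "\<dots> \<le> c\<^sup>2 * (d\<^sup>2 * sqnorm v)" using assms v by (intro mult_left_mono) (auto simp: opnorm_le_def)
  finally show "sqnorm ((S * T) *\<^sub>v v) \<le> (c * d)\<^sup>2 * sqnorm v" by (simp add: power_mult_distrib mult.assoc)
qed

lemma sqnorm_mult_vec:
  assumes "T \<in> carrier_mat n n" "v \<in> carrier_vec n"
  shows "of_real (sqnorm (T *\<^sub>v v)) = ((T\<^sup>\<dagger> * T) *\<^sub>v v) \<bullet>c v"
proof -
  have "((T\<^sup>\<dagger> * T) *\<^sub>v v) \<bullet>c v = (T\<^sup>\<dagger> *\<^sub>v (T *\<^sub>v v)) \<bullet>c v"
    using assms by (simp add: assoc_mult_mat_vec[of _ n n _ n] mat_adjoint_carrier)
  also have "\<dots> = (T *\<^sub>v v) \<bullet>c (T *\<^sub>v v)"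
    using assms by (subst scalar_prod_adjoint[of _ n]) (auto simp: mat_adjoint_carrier)
  finally show ?thesis unfolding cscalar_self ..
qed

lemma unitary_adjoint:
  assumes "U \<in> unitary_mats n" shows "U\<^sup>\<dagger> \<in> unitary_mats n"
  using unitaryD(1,5)[OF assms] by (simp add: unitary_mats_def mat_adjoint_carrier)

lemma unitary_adjoint_mult_vec:
  assumes "U \<in> unitary_mats n" "v \<in> carrier_vec n" shows "U\<^sup>\<dagger> *\<^sub>v v \<in> carrier_vec n"
  using mult_mat_vec_carrier[OF mat_adjoint_carrier[OF unitaryD(1)[OF assms(1)]] assms(2)] .

lemma sqnorm_unitary:
  assumes "U \<in> unitary_mats n" "v \<in> carrier_vec n"
  shows "sqnorm (U *\<^sub>v v) = sqnorm v"
proof -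
  have "complex_of_real (sqnorm (U *\<^sub>v v)) = of_real (sqnorm v)"
    unfolding sqnorm_mult_vec[OF unitaryD(1)[OF assms(1)] assms(2)] unitaryD(4)[OF assms(1)]
    using assms(2) by (simp add: cscalar_self)
  then show ?thesis by simp
qed

lemma carrier_conj_diag:
  assumes "U \<in> unitary_mats n" shows "U * real_diag n d * U\<^sup>\<dagger> \<in> carrier_mat n n"
  using unitaryD(2,3)[OF assms] by auto

lemma adjoint_conj_diag:
  assumes "U \<in> unitary_mats n"
  shows "(U * real_diag n d * U\<^sup>\<dagger>)\<^sup>\<dagger> = U * real_diag n d * U\<^sup>\<dagger>"
  using unitaryD(2,3)[OF assms] by (simp add: adjoint_mult mat_assoc)

lemma conj_diag_mult_vec:
  assumes "U \<in> unitary_mats n" "v \<in> carrier_vec n"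
  shows "(U * real_diag n d * U\<^sup>\<dagger>) *\<^sub>v v = U *\<^sub>v (real_diag n d *\<^sub>v (U\<^sup>\<dagger> *\<^sub>v v))"
proof -
  note U = unitaryD(1)[OF assms(1)] and w = unitary_adjoint_mult_vec[OF assms]
  show ?thesis
    unfolding assoc_mult_mat_vec[OF mult_carrier_mat[OF U real_diag_carrier] mat_adjoint_carrier[OF U] assms(2)]
      assoc_mult_mat_vec[OF U real_diag_carrier w] ..
qed

lemma real_diag_mult_vec:
  assumes "v \<in> carrier_vec n"
  shows "real_diag n d *\<^sub>v v = vec n (\<lambda>i. of_real (d i) * v $ i)"
proof (rule eq_vecI)
  fix i assume "i < dim_vec (vec n (\<lambda>i. of_real (d i) * v $ i))"
  then have i: "i < n" by simp
  have "(real_diag n d *\<^sub>v v) $ i = (\<Sum>j<n. (if j = i then of_real (d i) * v $ i else 0))"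
    using i assms by (auto simp: scalar_prod_def lessThan_atLeast0 simp del: sum.delta sum.delta' intro!: sum.cong)
  then show "(real_diag n d *\<^sub>v v) $ i = vec n (\<lambda>i. of_real (d i) * v $ i) $ i"
    using i by simp
qed auto

lemma quadratic_form_conj_diag:
  assumes U: "U \<in> unitary_mats n" and v: "v \<in> carrier_vec n"
  shows "((U * real_diag n d * U\<^sup>\<dagger>) *\<^sub>v v) \<bullet>c v = of_real (\<Sum>i<n. d i * (cmod ((U\<^sup>\<dagger> *\<^sub>v v) $ i))\<^sup>2)"
proof -
  have w: "U\<^sup>\<dagger> *\<^sub>v v \<in> carrier_vec n" using unitary_adjoint_mult_vec[OF U] v by blast
  have "((U * real_diag n d * U\<^sup>\<dagger>) *\<^sub>v v) \<bullet>c v = (real_diag n d *\<^sub>v (U\<^sup>\<dagger> *\<^sub>v v)) \<bullet>c (U\<^sup>\<dagger> *\<^sub>v v)"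
    unfolding conj_diag_mult_vec[OF assms]
    by (rule scalar_prod_adjoint) (use unitaryD[OF U] v w in \<open>auto simp: real_diag_mult_vec\<close>)
  also have "\<dots> = of_real (\<Sum>i<n. d i * (cmod ((U\<^sup>\<dagger> *\<^sub>v v) $ i))\<^sup>2)"
    unfolding real_diag_mult_vec[OF w] using carrier_vecD[OF w]
    by (simp add: scalar_prod_def lessThan_atLeast0 mult.assoc complex_norm_square[symmetric]
        del: index_mult_mat_vec dim_mult_mat_vec)
  finally show ?thesis .
qed

lemma unitary_unit_vec:
  assumes U: "U \<in> unitary_mats n" and i: "i < n"
  shows "U *\<^sub>v unit_vec n i \<in> carrier_vec n" "sqnorm (U *\<^sub>v unit_vec n i) = 1"
proof -
  have u: "unit_vec n i \<in> carrier_vec n" by simp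
  show "U *\<^sub>v unit_vec n i \<in> carrier_vec n" using unitaryD(1)[OF U] by simp
  show "sqnorm (U *\<^sub>v unit_vec n i) = 1" unfolding sqnorm_unitary[OF U u] sqnorm_sum[OF u]
    using i by (simp add: unit_vec_def if_distrib[of cmod] if_distrib[of "\<lambda>x. x\<^sup>2"] cong: if_cong)
qed

lemma conj_diag_eigenvector:
  assumes U: "U \<in> unitary_mats n" and i: "i < n"
  shows "(U * real_diag n d * U\<^sup>\<dagger>) *\<^sub>v (U *\<^sub>v unit_vec n i) = of_real (d i) \<cdot>\<^sub>v (U *\<^sub>v unit_vec n i)"
proof -
  have u: "unit_vec n i \<in> carrier_vec n" by simp
  have "U\<^sup>\<dagger> *\<^sub>v (U *\<^sub>v unit_vec n i) = unit_vec n i"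
    using assoc_mult_mat_vec[OF mat_adjoint_carrier[OF unitaryD(1)[OF U]] unitaryD(1)[OF U] u]
    unfolding unitaryD(4)[OF U] by simp
  moreover have "real_diag n d *\<^sub>v unit_vec n i = of_real (d i) \<cdot>\<^sub>v unit_vec n i"
    unfolding real_diag_mult_vec[OF u] by (rule eq_vecI) (auto simp: unit_vec_def)
  ultimately show ?thesis
    unfolding conj_diag_mult_vec[OF U unitary_unit_vec(1)[OF U i]]
    using mult_mat_vec[OF unitaryD(1)[OF U] u] by simp
qed

lemma opnorm_le_conj_diag:
  assumes U: "U \<in> unitary_mats n" and c: "0 \<le> c"
  shows "opnorm_le n (U * real_diag n d * U\<^sup>\<dagger>) c \<longleftrightarrow> (\<forall>i<n. \<bar>d i\<bar> \<le> c)"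
proof
  assume *: "opnorm_le n (U * real_diag n d * U\<^sup>\<dagger>) c"
  show "\<forall>i<n. \<bar>d i\<bar> \<le> c"
  proof (intro allI impI)
    fix i assume "i < n"
    note ev = unitary_unit_vec[OF U this] conj_diag_eigenvector[OF U this]
    have "(d i)\<^sup>2 \<le> c\<^sup>2" using *[unfolded opnorm_le_def, rule_format, OF ev(1)]
      unfolding ev(3) sqnorm_smult ev(2) by simp
    then show "\<bar>d i\<bar> \<le> c" using c abs_le_square_iff[of "d i" c] by simp
  qed
next
  assume *: "\<forall>i<n. \<bar>d i\<bar> \<le> c"
  show "opnorm_le n (U * real_diag n d * U\<^sup>\<dagger>) c" unfolding opnorm_le_def
  proof
    fix v :: "complex vec" assume v: "v \<in> carrier_vec n"
    have w: "U\<^sup>\<dagger> *\<^sub>v v \<in> carrier_vec n" using unitary_adjoint_mult_vec[OF U] v by blast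
    have "sqnorm ((U * real_diag n d * U\<^sup>\<dagger>) *\<^sub>v v) = sqnorm (real_diag n d *\<^sub>v (U\<^sup>\<dagger> *\<^sub>v v))"
      unfolding conj_diag_mult_vec[OF U v]
      by (rule sqnorm_unitary[OF U]) (use w in \<open>simp add: real_diag_mult_vec\<close>)
    also have "\<dots> = (\<Sum>i<n. (d i)\<^sup>2 * (cmod ((U\<^sup>\<dagger> *\<^sub>v v) $ i))\<^sup>2)"
      unfolding real_diag_mult_vec[OF w]
      by (simp add: sqnorm_sum[of _ n] norm_mult power_mult_distrib del: index_mult_mat_vec)
    also have "\<dots> \<le> (\<Sum>i<n. c\<^sup>2 * (cmod ((U\<^sup>\<dagger> *\<^sub>v v) $ i))\<^sup>2)"
      using * c by (intro sum_mono mult_right_mono) (auto simp flip: abs_le_square_iff)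
    also have "\<dots> = c\<^sup>2 * sqnorm v"
      using sqnorm_sum[OF w] sqnorm_unitary[OF unitary_adjoint[OF U] v] by (simp add: sum_distrib_left)
    finally show "sqnorm ((U * real_diag n d * U\<^sup>\<dagger>) *\<^sub>v v) \<le> c\<^sup>2 * sqnorm v" .
  qed
qed

text \<open>With \<open>T\<^sup>\<dagger> T = U diag(d) U\<^sup>\<dagger>\<close>, the numbers \<open>d\<^sub>i\<close> are the values
  of \<open>\<parallel>T v\<parallel>\<^sup>2\<close> at the columns of \<open>U\<close>, and \<open>\<parallel>T v\<parallel>\<^sup>2\<close> at a unit vector \<open>v\<close> is the mean of the \<open>d\<^sub>i\<close> with
  weights \<open>|(U\<^sup>\<dagger> v)\<^sub>i|\<^sup>2\<close>. So the largest \<open>d\<^sub>i\<close> is both \<open>\<parallel>T\<^sup>\<dagger> T\<parallel>\<close> and \<open>\<parallel>T\<parallel>\<^sup>2\<close>.\<close>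

lemma opnorm_le_self_adjoint_square:
  assumes T: "T \<in> carrier_mat n n" and c: "0 \<le> c"
  shows "opnorm_le n (T\<^sup>\<dagger> * T) (c\<^sup>2) \<longleftrightarrow> opnorm_le n T c"
proof -
  have "T\<^sup>\<dagger> * T \<in> carrier_mat n n" "(T\<^sup>\<dagger> * T)\<^sup>\<dagger> = T\<^sup>\<dagger> * T"
    using T by (auto simp: adjoint_mult)
  then obtain U d where U: "U \<in> unitary_mats n" and TT: "T\<^sup>\<dagger> * T = U * real_diag n d * U\<^sup>\<dagger>"
    by (rule hermitian_diagonalization)
  have q: "sqnorm (T *\<^sub>v v) = (\<Sum>i<n. d i * (cmod ((U\<^sup>\<dagger> *\<^sub>v v) $ i))\<^sup>2)" if "v \<in> carrier_vec n" for v
    using sqnorm_mult_vec[OF T that] quadratic_form_conj_diag[OF U that, of d]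
    unfolding TT by (simp only: of_real_eq_iff)
  have d: "d i = sqnorm (T *\<^sub>v (U *\<^sub>v unit_vec n i))" if "i < n" for i
  proof -
    note ev = unitary_unit_vec[OF U that] conj_diag_eigenvector[OF U that]
    have "complex_of_real (sqnorm (T *\<^sub>v (U *\<^sub>v unit_vec n i))) = of_real (d i)"
      unfolding sqnorm_mult_vec[OF T ev(1)] TT ev(3)
      using ev(2) carrier_vecD[OF ev(1)] by (simp add: cscalar_self del: index_mult_mat_vec)
    then show ?thesis by simp
  qed
  show ?thesis unfolding TT opnorm_le_conj_diag[OF U zero_le_power2]
  proof
    assume *: "\<forall>i<n. \<bar>d i\<bar> \<le> c\<^sup>2"
    show "opnorm_le n T c" unfolding opnorm_le_def
    proof
      fix v :: "complex vec" assume v: "v \<in> carrier_vec n"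
      have w: "U\<^sup>\<dagger> *\<^sub>v v \<in> carrier_vec n" using unitary_adjoint_mult_vec[OF U] v by blast
      have "sqnorm (T *\<^sub>v v) \<le> (\<Sum>i<n. c\<^sup>2 * (cmod ((U\<^sup>\<dagger> *\<^sub>v v) $ i))\<^sup>2)"
        unfolding q[OF v] using * by (intro sum_mono mult_right_mono) auto
      also have "\<dots> = c\<^sup>2 * sqnorm v"
        using sqnorm_sum[OF w] sqnorm_unitary[OF unitary_adjoint[OF U] v] by (simp add: sum_distrib_left)
      finally show "sqnorm (T *\<^sub>v v) \<le> c\<^sup>2 * sqnorm v" .
    qed
  next
    assume "opnorm_le n T c"
    then show "\<forall>i<n. \<bar>d i\<bar> \<le> c\<^sup>2"
      using d unitary_unit_vec[OF U] sqnorm_nonneg by (metis abs_of_nonneg mult.right_neutral opnorm_le_def)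
  qed
qed

text \<open>\<open>K L\<close> and \<open>L K\<close> have the same nonzero eigenvalues: if \<open>v\<close> is an eigenvector of \<open>K L\<close> then
  \<open>L v\<close> is one of \<open>L K\<close>. For Hermitian \<open>K L\<close> the norm is the spectral radius, which never
  exceeds \<open>\<parallel>L K\<parallel>\<close>.\<close>

lemma opnorm_le_swap:
  assumes K: "K \<in> carrier_mat n n" and L: "L \<in> carrier_mat n n" and herm: "(K * L)\<^sup>\<dagger> = K * L"
    and c: "0 \<le> c" and LK: "opnorm_le n (L * K) c"
  shows "opnorm_le n (K * L) c"
proof -
  obtain U d where U: "U \<in> unitary_mats n" and KL: "K * L = U * real_diag n d * U\<^sup>\<dagger>"
    using hermitian_diagonalization[OF mult_carrier_mat[OF K L] herm] .
  have "\<bar>d i\<bar> \<le> c" if "i < n" for i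
  proof (cases "d i = 0")
    case False
    define v where "v = U *\<^sub>v unit_vec n i"
    note ev = unitary_unit_vec[OF U that, folded v_def] conj_diag_eigenvector[OF U that, of d, folded v_def KL]
    have KLv: "K *\<^sub>v (L *\<^sub>v v) = of_real (d i) \<cdot>\<^sub>v v"
      using ev(1,3) assoc_mult_mat_vec[OF K L ev(1)] by simp
    have w: "L *\<^sub>v v \<in> carrier_vec n" using L ev(1) by simp
    have "sqnorm (L *\<^sub>v v) \<noteq> 0"
    proof
      assume "sqnorm (L *\<^sub>v v) = 0"
      then have "L *\<^sub>v v = 0\<^sub>v n" using sqnorm_eq_0[OF w] by simp
      moreover have "K *\<^sub>v 0\<^sub>v n = 0\<^sub>v n" by (rule eq_vecI) (use K in auto)
      ultimately have "of_real (d i) \<cdot>\<^sub>v v = 0\<^sub>v n" using KLv by simp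
      then have "(cmod (of_real (d i)))\<^sup>2 * sqnorm v = 0"
        unfolding sqnorm_smult[symmetric] using sqnorm_eq_0[of "0\<^sub>v n" n] by simp
      then show False using False ev(2) by simp
    qed
    then have pos: "sqnorm (L *\<^sub>v v) > 0" using sqnorm_nonneg[of "L *\<^sub>v v"] by simp
    have "(L * K) *\<^sub>v (L *\<^sub>v v) = of_real (d i) \<cdot>\<^sub>v (L *\<^sub>v v)"
      using assoc_mult_mat_vec[OF L K w] KLv mult_mat_vec[OF L ev(1)] by simp
    then have "(d i)\<^sup>2 * sqnorm (L *\<^sub>v v) \<le> c\<^sup>2 * sqnorm (L *\<^sub>v v)"
      using LK w by (metis opnorm_le_def sqnorm_smult norm_of_real power2_abs)
    then have "(d i)\<^sup>2 \<le> c\<^sup>2" using pos by simp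
    then show ?thesis using c abs_le_square_iff[of "d i" c] by simp
  qed (use c in simp)
  then show ?thesis unfolding KL opnorm_le_conj_diag[OF U c] by blast
qed

lemma opnorm_le_adjoint:
  assumes T: "T \<in> carrier_mat n n" and c: "0 \<le> c" and "opnorm_le n T c"
  shows "opnorm_le n (T\<^sup>\<dagger>) c"
proof -
  note T' = mat_adjoint_carrier[OF T]
  have "opnorm_le n (T * T\<^sup>\<dagger>) (c\<^sup>2)"
    by (rule opnorm_le_swap)
      (use T T' assms opnorm_le_self_adjoint_square[OF T c] in \<open>auto simp: adjoint_mult\<close>)
  then show ?thesis using opnorm_le_self_adjoint_square[OF T' c] by simp
qed

text \<open>The norm of \<open>T\<close> depends only on \<open>T T\<^sup>\<dagger>\<close>; this replaces a factor by another square root of the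
  same positive semidefinite matrix.\<close>

lemma opnorm_le_cong_square:
  assumes "S \<in> carrier_mat n n" "T \<in> carrier_mat n n" "S * S\<^sup>\<dagger> = T * T\<^sup>\<dagger>" "0 \<le> c" "opnorm_le n S c"
  shows "opnorm_le n T c"
proof -
  have "opnorm_le n (S\<^sup>\<dagger>) c" using assms opnorm_le_adjoint by blast
  then have "opnorm_le n (T\<^sup>\<dagger>) c"
    using assms opnorm_le_self_adjoint_square[OF mat_adjoint_carrier]
    by (metis adjoint_adjoint)
  then show ?thesis using opnorm_le_adjoint[OF mat_adjoint_carrier[OF assms(2)] assms(4)] by simp
qed

section \<open>Powers of positive semidefinite matrices\<close>

notation mat_powr (infixr "\<^bold>^" 80)

lemma psd_matsD:
  assumes "X \<in> psd_mats n"
  shows "X \<in> carrier_mat n n" "dim_row X = n" "dim_col X = n" "X\<^sup>\<dagger> = X"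
  using assms by (auto simp: psd_mats_def)

lemma pd_imp_psd: "X \<in> pd_mats n \<Longrightarrow> X \<in> psd_mats n"
proof -
  assume X: "X \<in> pd_mats n"
  have "0 \<le> (X *\<^sub>v v) \<bullet>c v" if "v \<in> carrier_vec n" for v
    by (cases "v = 0\<^sub>v n") (use X that in \<open>auto simp: pd_mats_def less_imp_le\<close>)
  then show ?thesis using X by (simp add: psd_mats_def pd_mats_def)
qed

lemma psd_conj_diag_nonneg:
  assumes U: "U \<in> unitary_mats n" and psd: "U * real_diag n d * U\<^sup>\<dagger> \<in> psd_mats n" and i: "i < n"
  shows "0 \<le> d i"
proof -
  note ev = unitary_unit_vec[OF U i] conj_diag_eigenvector[OF U i, of d]
  have "0 \<le> ((U * real_diag n d * U\<^sup>\<dagger>) *\<^sub>v (U *\<^sub>v unit_vec n i)) \<bullet>c (U *\<^sub>v unit_vec n i)"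
    using psd ev(1) by (simp add: psd_mats_def del: index_mult_mat_vec)
  then show ?thesis unfolding ev(3) using ev(1,2) by (simp add: cscalar_self less_eq_complex_def)
qed

text \<open>Only \<open>d\<^sub>i\<close> with \<open>i < n\<close> matter; asking for the sign at all \<open>i\<close> saves index conditions later.\<close>

lemma psd_diagonalization:
  assumes "X \<in> psd_mats n"
  obtains U d where "U \<in> unitary_mats n" "\<forall>i. 0 \<le> d i" "X = U * real_diag n d * U\<^sup>\<dagger>"
proof -
  obtain U d where U: "U \<in> unitary_mats n" and X: "X = U * real_diag n d * U\<^sup>\<dagger>"
    using hermitian_diagonalization psd_matsD[OF assms] by metis
  have "0 \<le> d i" if "i < n" for i
    using psd_conj_diag_nonneg[OF U _ that] assms X by blast
  moreover have "real_diag n d = real_diag n (\<lambda>i. if i < n then d i else 0)"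
    by (rule real_diag_cong) simp
  ultimately show ?thesis using U X by (intro that[of U "\<lambda>i. if i < n then d i else 0"]) auto
qed

lemma pd_diagonalization:
  assumes "X \<in> pd_mats n"
  obtains U d where "U \<in> unitary_mats n" "\<forall>i. 0 < d i" "X = U * real_diag n d * U\<^sup>\<dagger>"
proof -
  obtain U d where U: "U \<in> unitary_mats n" and X: "X = U * real_diag n d * U\<^sup>\<dagger>"
    using psd_diagonalization[OF pd_imp_psd[OF assms]] by metis
  have "0 < d i" if "i < n" for i
  proof -
    note ev = unitary_unit_vec[OF U that] conj_diag_eigenvector[OF U that, of d, folded X]
    have "U *\<^sub>v unit_vec n i \<noteq> 0\<^sub>v n" using ev(2) sqnorm_eq_0[OF ev(1)] by auto
    then have "0 < (X *\<^sub>v (U *\<^sub>v unit_vec n i)) \<bullet>c (U *\<^sub>v unit_vec n i)"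
      using assms ev(1) by (simp add: pd_mats_def)
    then show ?thesis unfolding ev(3) using ev(1,2) by (simp add: cscalar_self less_complex_def)
  qed
  moreover have "real_diag n d = real_diag n (\<lambda>i. if i < n then d i else 1)"
    by (rule real_diag_cong) simp
  ultimately show ?thesis using U X by (intro that[of U "\<lambda>i. if i < n then d i else 1"]) auto
qed

lemma psd_conj_diag:
  assumes "U \<in> unitary_mats n" "\<And>i. i < n \<Longrightarrow> 0 \<le> d i"
  shows "U * real_diag n d * U\<^sup>\<dagger> \<in> psd_mats n"
  using assms(2)
  by (auto simp: psd_mats_def carrier_conj_diag[OF assms(1)] adjoint_conj_diag[OF assms(1)]
      quadratic_form_conj_diag[OF assms(1)] less_eq_complex_def intro!: sum_nonneg
      simp del: index_mult_mat_vec)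

lemma pd_conj_diag:
  assumes U: "U \<in> unitary_mats n" and pos: "\<And>i. i < n \<Longrightarrow> 0 < d i"
  shows "U * real_diag n d * U\<^sup>\<dagger> \<in> pd_mats n"
proof -
  have "0 < ((U * real_diag n d * U\<^sup>\<dagger>) *\<^sub>v v) \<bullet>c v" if v: "v \<in> carrier_vec n" "v \<noteq> 0\<^sub>v n" for v
  proof -
    let ?w = "U\<^sup>\<dagger> *\<^sub>v v"
    have w: "?w \<in> carrier_vec n" using unitary_adjoint_mult_vec[OF U] v by blast
    have "sqnorm ?w \<noteq> 0" using sqnorm_unitary[OF unitary_adjoint[OF U] v(1)] sqnorm_eq_0[OF v(1)] v(2) by simp
    then obtain i where i: "i < n" "?w $ i \<noteq> 0"
      unfolding sqnorm_sum[OF w] by (metis (no_types, lifting) lessThan_iff norm_zero sum.neutral zero_power2)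
    have "0 < (\<Sum>i<n. d i * (cmod (?w $ i))\<^sup>2)"
      by (rule sum_pos2[of _ i]) (use i pos in \<open>auto simp: less_imp_le simp del: index_mult_mat_vec\<close>)
    then show ?thesis unfolding quadratic_form_conj_diag[OF U v(1)] by (simp add: less_complex_def)
  qed
  then show ?thesis by (simp add: pd_mats_def carrier_conj_diag[OF U] adjoint_conj_diag[OF U])
qed

lemma psd_adjoint_mult:
  assumes T: "T \<in> carrier_mat n n"
  shows "T\<^sup>\<dagger> * T \<in> psd_mats n"
proof -
  have "0 \<le> ((T\<^sup>\<dagger> * T) *\<^sub>v v) \<bullet>c v" if "v \<in> carrier_vec n" for v
    unfolding sqnorm_mult_vec[OF T that, symmetric] by (simp add: less_eq_complex_def sqnorm_nonneg)
  then show ?thesis using T by (auto simp: psd_mats_def adjoint_mult)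
qed

lemma psd_mult_adjoint:
  assumes "T \<in> carrier_mat n n" shows "T * T\<^sup>\<dagger> \<in> psd_mats n"
  using psd_adjoint_mult[OF mat_adjoint_carrier[OF assms]] by simp

lemma psd_powr: "X \<in> psd_mats n \<Longrightarrow> X \<^bold>^ p \<in> psd_mats n"
  by (elim psd_diagonalization) (simp add: mat_powr_eq psd_conj_diag)

lemma pd_powr: "X \<in> pd_mats n \<Longrightarrow> X \<^bold>^ p \<in> pd_mats n"
  by (elim pd_diagonalization) (metis mat_powr_eq pd_conj_diag powr_gt_zero less_irrefl)

lemma conj_diag_mult:
  assumes "U \<in> unitary_mats n"
  shows "(U * real_diag n d * U\<^sup>\<dagger>) * (U * real_diag n e * U\<^sup>\<dagger>) = U * real_diag n (\<lambda>i. d i * e i) * U\<^sup>\<dagger>"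
proof -
  have "real_diag n d * (real_diag n e * U\<^sup>\<dagger>) = real_diag n (\<lambda>i. d i * e i) * U\<^sup>\<dagger>"
    using unitaryD[OF assms] by (simp add: mat_assoc flip: real_diag_mult)
  then show ?thesis using unitaryD[OF assms] by (simp add: mat_assoc mult_mat_cancel_left)
qed

text \<open>For singular \<open>X\<close> the convention \<open>0 powr p = 0\<close> makes \<open>X\<^sup>0\<close> the projection onto the range of \<open>X\<close>,
  and the law of exponents holds for all real exponents.\<close>

lemma mat_powr_add: "X \<in> psd_mats n \<Longrightarrow> X \<^bold>^ s * X \<^bold>^ t = X \<^bold>^ (s + t)"
  by (elim psd_diagonalization) (simp add: mat_powr_eq conj_diag_mult powr_add)

lemma mat_powr_add_left:
  assumes "X \<in> psd_mats n" "dim_row Z = n"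
  shows "X \<^bold>^ s * (X \<^bold>^ t * Z) = X \<^bold>^ (s + t) * Z"
  using assms psd_matsD[OF psd_powr[OF assms(1)]] by (simp add: mat_assoc flip: mat_powr_add)

lemma mat_powr_powr: "X \<in> psd_mats n \<Longrightarrow> (X \<^bold>^ s) \<^bold>^ t = X \<^bold>^ (s * t)"
  by (elim psd_diagonalization) (simp add: mat_powr_eq powr_powr)

lemma mat_powr_one: "X \<in> psd_mats n \<Longrightarrow> X \<^bold>^ 1 = X"
  by (elim psd_diagonalization) (simp add: mat_powr_eq)

lemma mat_powr_zero: "X \<in> pd_mats n \<Longrightarrow> X \<^bold>^ 0 = 1\<^sub>m n"
proof (elim pd_diagonalization)
  fix U d assume U: "U \<in> unitary_mats n" and d: "\<forall>i. 0 < d i" and X: "X = U * real_diag n d * U\<^sup>\<dagger>"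
  have "d i powr 0 = 1" for i using spec[OF d, of i] by simp
  then have "X \<^bold>^ 0 = U * real_diag n (\<lambda>i. 1) * U\<^sup>\<dagger>" unfolding X mat_powr_eq[OF U] by simp
  also have "real_diag n (\<lambda>i. 1) = 1\<^sub>m n" by (rule eq_matI) auto
  finally show ?thesis using unitaryD[OF U] by simp
qed

lemma opnorm_le_powr:
  assumes "X \<in> psd_mats n" "p > 0"
  shows "opnorm_le n (X \<^bold>^ p) 1 \<longleftrightarrow> opnorm_le n X 1"
proof -
  obtain U d where U: "U \<in> unitary_mats n" and d: "\<forall>i. 0 \<le> d i" and X: "X = U * real_diag n d * U\<^sup>\<dagger>"
    using psd_diagonalization[OF assms(1)] .
  have "d i powr p \<le> 1 \<longleftrightarrow> d i \<le> 1" for i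
    using powr_le_cancel_iff powr_mono2[of p "d i" 1] powr_less_mono2[of p 1 "d i"] spec[OF d, of i] assms(2)
    by (fastforce simp: not_le[symmetric])
  then show ?thesis unfolding X mat_powr_eq[OF U]
    using d by (simp add: opnorm_le_conj_diag[OF U])
qed

text \<open>A crude uniform bound, from \<open>d\<^sup>s \<le> 1 + d\<close>; it starts the iteration in the Cordes inequality.\<close>

lemma opnorm_powr_bounded:
  assumes "X \<in> psd_mats n"
  obtains M where "1 \<le> M" "\<And>s. 0 \<le> s \<Longrightarrow> s \<le> 1 \<Longrightarrow> opnorm_le n (X \<^bold>^ s) M"
proof -
  obtain U d where U: "U \<in> unitary_mats n" and d: "\<forall>i. 0 \<le> d i" and X: "X = U * real_diag n d * U\<^sup>\<dagger>"
    using psd_diagonalization[OF assms] .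
  have M: "0 \<le> 1 + sum d {..<n}" using d by (simp add: sum_nonneg)
  have "d i powr s \<le> 1 + sum d {..<n}" if "i < n" "0 \<le> s" "s \<le> 1" for i s
  proof -
    have "d i powr s \<le> 1 + d i"
    proof (cases "d i \<le> 1")
      case True then show ?thesis using powr_mono2[of s "d i" 1] spec[OF d, of i] that by simp
    next
      case False then show ?thesis using powr_mono[of s 1 "d i"] spec[OF d, of i] that by simp
    qed
    also have "d i \<le> sum d {..<n}" using d that by (intro member_le_sum) auto
    finally show ?thesis by simp
  qed
  then have "opnorm_le n (X \<^bold>^ s) (1 + sum d {..<n})" if "0 \<le> s" "s \<le> 1" for s
    unfolding X mat_powr_eq[OF U] opnorm_le_conj_diag[OF U M] using that by simp
  then show ?thesis using M d by (intro that[of "1 + sum d {..<n}"]) (auto simp: sum_nonneg)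
qed

section \<open>The Cordes inequality\<close>

text \<open>The step of Pedersen's argument for \<open>F(s) = \<parallel>X\<^sup>s Y\<^sup>s\<parallel>\<close>: \<open>F(s)\<^sup>2\<close> is the norm of
  \<open>X\<^sup>s Y\<^sup>2\<^sup>s X\<^sup>s\<close>, and moving a power of \<open>X\<close> from the right end to the left by \<open>opnorm_le_swap\<close>
  turns this into \<open>X\<^sup>t Y\<^sup>2\<^sup>s X\<^sup>u\<close> with \<open>t + u = 2s\<close>, whose norm is at most \<open>F(t) F(u)\<close>.\<close>

lemma cordes_halving:
  assumes X: "X \<in> psd_mats n" and Y: "Y \<in> psd_mats n" and c: "0 \<le> c"
    and st: "opnorm_le n (X \<^bold>^ t * Y \<^bold>^ (2 * s) * X \<^bold>^ (2 * s - t)) c"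
  shows "opnorm_le n (X \<^bold>^ s * Y \<^bold>^ s) (sqrt c)"
proof -
  note Xp = psd_matsD[OF psd_powr[OF X]] and Yp = psd_matsD[OF psd_powr[OF Y]]
  let ?T = "Y \<^bold>^ s * X \<^bold>^ s" and ?K = "X \<^bold>^ s * Y \<^bold>^ (2 * s) * X \<^bold>^ (2 * s - t)" and ?L = "X \<^bold>^ (t - s)"
  have T: "?T \<in> carrier_mat n n" using Xp(1) Yp(1) by (rule mult_carrier_mat[rotated])
  have KL: "?K * ?L = ?T\<^sup>\<dagger> * ?T"
    using Xp Yp by (simp add: adjoint_mult mat_assoc mat_powr_add[OF X] mat_powr_add_left[OF Y])
  have LK: "?L * ?K = X \<^bold>^ t * Y \<^bold>^ (2 * s) * X \<^bold>^ (2 * s - t)"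
    using Xp Yp by (simp add: mat_assoc mat_powr_add_left[OF X])
  have "opnorm_le n (?K * ?L) c"
  proof (rule opnorm_le_swap[OF _ _ _ c])
    show "(?K * ?L)\<^sup>\<dagger> = ?K * ?L" unfolding KL using T by (simp add: adjoint_mult)
  qed (use Xp Yp st LK in auto)
  then have "opnorm_le n ?T (sqrt c)"
    unfolding KL using opnorm_le_self_adjoint_square[OF T, of "sqrt c"] c by simp
  then have "opnorm_le n (?T\<^sup>\<dagger>) (sqrt c)" using T c by (intro opnorm_le_adjoint) auto
  then show ?thesis using Xp Yp by (simp add: adjoint_mult)
qed

text \<open>Let \<open>F(s) = \<parallel>X\<^sup>s Y\<^sup>s\<parallel>\<close>, so that \<open>F(0) \<le> 1\<close> and \<open>F(1) \<le> 1\<close>. By \<open>cordes_halving\<close>, \<open>F(s)\<^sup>2\<close> is at most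
  \<open>F(2s)\<close> if \<open>s \<le> 1/2\<close> and at most \<open>F(2s - 1)\<close> otherwise, and the new argument is again in
  \<open>[0, 1]\<close>. As \<open>F \<le> M\<close> on \<open>[0, 1]\<close>, iterating \<open>k\<close> times gives \<open>F(s) \<le> M powr (1/2)\<^sup>k\<close>, which tends
  to \<open>1\<close>.\<close>

lemma cordes_inequality:
  assumes X: "X \<in> psd_mats n" and Y: "Y \<in> psd_mats n" and XY: "opnorm_le n (X * Y) 1"
    and s: "0 \<le> s" "s \<le> 1"
  shows "opnorm_le n (X \<^bold>^ s * Y \<^bold>^ s) 1"
proof -
  note Xp = psd_matsD[OF psd_powr[OF X]] and Yp = psd_matsD[OF psd_powr[OF Y]]
  obtain M1 where M1: "1 \<le> M1" "\<And>s. 0 \<le> s \<Longrightarrow> s \<le> 1 \<Longrightarrow> opnorm_le n (X \<^bold>^ s) M1"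
    using opnorm_powr_bounded[OF X] by blast
  obtain M2 where M2: "1 \<le> M2" "\<And>s. 0 \<le> s \<Longrightarrow> s \<le> 1 \<Longrightarrow> opnorm_le n (Y \<^bold>^ s) M2"
    using opnorm_powr_bounded[OF Y] by blast
  define M where "M = M1 * M2"
  have M: "M > 0" using M1(1) M2(1) by (simp add: M_def)
  have bound: "opnorm_le n (X \<^bold>^ s * Y \<^bold>^ s) (M powr ((1/2) ^ k))" if "0 \<le> s" "s \<le> 1" for s k
    using that
  proof (induction k arbitrary: s)
    case 0
    then show ?case using opnorm_le_mult[OF Xp(1) Yp(1) M1(2) M2(2)] M by (simp add: M_def)
  next
    case (Suc k)
    let ?c = "M powr ((1/2) ^ k)"
    have "opnorm_le n (X \<^bold>^ s * Y \<^bold>^ s) (sqrt ?c)"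
    proof (cases "s \<le> 1/2")
      case True
      show ?thesis
      proof (rule cordes_halving[OF X Y, of _ "2 * s"])
        obtain U d where U: "U \<in> unitary_mats n" and d: "X = U * real_diag n d * U\<^sup>\<dagger>"
          using psd_diagonalization[OF X] by metis
        have "opnorm_le n (X \<^bold>^ 0) 1" unfolding d mat_powr_eq[OF U] opnorm_le_conj_diag[OF U zero_le_one] by simp
        then have "opnorm_le n (X \<^bold>^ (2 * s) * Y \<^bold>^ (2 * s) * X \<^bold>^ 0) (?c * 1)"
          using Suc.IH[of "2 * s"] Suc.prems True Xp Yp
          by (intro opnorm_le_mult) auto
        then show "opnorm_le n (X \<^bold>^ (2 * s) * Y \<^bold>^ (2 * s) * X \<^bold>^ (2 * s - 2 * s)) ?c" by simp
      qed simp
    next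
      case False
      show ?thesis
      proof (rule cordes_halving[OF X Y, of _ 1])
        have "opnorm_le n ((X \<^bold>^ (2 * s - 1) * Y \<^bold>^ (2 * s - 1))\<^sup>\<dagger>) ?c"
          by (rule opnorm_le_adjoint) (use Suc False Xp Yp in auto)
        then have "opnorm_le n ((X * Y) * (X \<^bold>^ (2 * s - 1) * Y \<^bold>^ (2 * s - 1))\<^sup>\<dagger>) (1 * ?c)"
          using XY Xp Yp psd_matsD[OF X] psd_matsD[OF Y] by (intro opnorm_le_mult) auto
        moreover have "(X * Y) * (X \<^bold>^ (2 * s - 1) * Y \<^bold>^ (2 * s - 1))\<^sup>\<dagger>
            = (X \<^bold>^ 1 * Y \<^bold>^ 1) * (X \<^bold>^ (2 * s - 1) * Y \<^bold>^ (2 * s - 1))\<^sup>\<dagger>"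
          by (simp add: mat_powr_one[OF X] mat_powr_one[OF Y])
        moreover have "\<dots> = X \<^bold>^ 1 * Y \<^bold>^ (2 * s) * X \<^bold>^ (2 * s - 1)"
          using Xp Yp by (simp add: adjoint_mult mat_assoc mat_powr_add_left[OF Y])
        ultimately show "opnorm_le n (X \<^bold>^ 1 * Y \<^bold>^ (2 * s) * X \<^bold>^ (2 * s - 1)) ?c" by simp
      qed simp
    qed
    moreover have "sqrt ?c = M powr ((1/2) ^ Suc k)"
      using M by (simp add: powr_half_sqrt[symmetric] powr_powr mult.commute)
    ultimately show ?case by simp
  qed
  have "(\<lambda>k. (M powr ((1/2) ^ k))\<^sup>2) \<longlonglongrightarrow> (M powr 0)\<^sup>2"
    using M by (intro tendsto_intros LIMSEQ_power_zero) auto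
  then have lim: "(\<lambda>k. (M powr ((1/2) ^ k))\<^sup>2 * c) \<longlonglongrightarrow> 1\<^sup>2 * c" for c
    using M by (intro tendsto_mult tendsto_const) simp
  show ?thesis unfolding opnorm_le_def
    by (intro ballI LIMSEQ_le_const[OF lim]) (use bound[OF s] in \<open>auto simp: opnorm_le_def\<close>)
qed

section \<open>Contractivity of \<open>P\<^sub>\<alpha>\<^sub>,\<^sub>r(A, B)\<close> in terms of \<open>r\<close>\<close>

text \<open>From \<open>T (T\<^sup>\<dagger> T) = (T T\<^sup>\<dagger>) T\<close>: in diagonalizing bases of the two squares, \<open>T\<close> intertwines two
  diagonal matrices, hence also any function of them.\<close>

lemma mat_powr_intertwine:
  assumes T: "T \<in> carrier_mat n n"
  shows "T * (T\<^sup>\<dagger> * T) \<^bold>^ p = (T * T\<^sup>\<dagger>) \<^bold>^ p * T"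
proof -
  obtain U d where U: "U \<in> unitary_mats n" and N: "T\<^sup>\<dagger> * T = U * real_diag n d * U\<^sup>\<dagger>"
    using psd_diagonalization[OF psd_adjoint_mult[OF T]] by metis
  obtain V e where V: "V \<in> unitary_mats n" and M: "T * T\<^sup>\<dagger> = V * real_diag n e * V\<^sup>\<dagger>"
    using psd_diagonalization[OF psd_mult_adjoint[OF T]] by metis
  note Ud = unitaryD[OF U] and Vd = unitaryD[OF V]
  have Td: "dim_row T = n" "dim_col T = n" using T by auto
  let ?W = "V\<^sup>\<dagger> * (T * U)"
  have "?W * real_diag n d = V\<^sup>\<dagger> * (T * (U * real_diag n d * U\<^sup>\<dagger>) * U)"
    using Td Ud Vd by (simp add: mat_assoc)
  also have "\<dots> = V\<^sup>\<dagger> * ((V * real_diag n e * V\<^sup>\<dagger>) * T * U)"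
    unfolding N[symmetric] M[symmetric] using Td Ud by (simp add: mat_assoc)
  also have "\<dots> = real_diag n e * ?W"
    using Td Ud Vd by (simp add: mat_assoc mult_mat_cancel_left[of "V\<^sup>\<dagger>" V n])
  finally have "?W * real_diag n (\<lambda>i. d i powr p) = real_diag n (\<lambda>i. e i powr p) * ?W"
    by (rule real_diag_intertwine[rotated]) (use Td Ud Vd in auto)
  then have "V * (?W * real_diag n (\<lambda>i. d i powr p)) * U\<^sup>\<dagger> = V * (real_diag n (\<lambda>i. e i powr p) * ?W) * U\<^sup>\<dagger>"
    by simp
  then have "T * (U * real_diag n (\<lambda>i. d i powr p) * U\<^sup>\<dagger>) = (V * real_diag n (\<lambda>i. e i powr p) * V\<^sup>\<dagger>) * T"
    using Td Ud Vd by (simp add: mat_assoc mult_mat_cancel_left[of V "V\<^sup>\<dagger>" n])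
  then show ?thesis unfolding N M mat_powr_eq[OF U] mat_powr_eq[OF V] .
qed

lemma cordes_inequality_powr:
  assumes X: "X \<in> psd_mats n" and Y: "Y \<in> psd_mats n" and "opnorm_le n (X \<^bold>^ a * Y \<^bold>^ b) 1"
    and s: "0 \<le> s" "s \<le> 1" and "a' = a * s" "b' = b * s"
  shows "opnorm_le n (X \<^bold>^ a' * Y \<^bold>^ b') 1"
  using cordes_inequality[OF psd_powr[OF X] psd_powr[OF Y] assms(3) s] assms(6,7)
  by (simp add: mat_powr_powr[OF X] mat_powr_powr[OF Y])

text \<open>Put \<open>\<tau> = x + y\<close> and split \<open>A = A\<^bsup>x/\<tau>\<^esup> A\<^bsup>y/\<tau>\<^esup>\<close>. By the Cordes inequality both
  \<open>A\<^bsup>x/\<tau>\<^esup> C\<^sup>x\<close> and \<open>A\<^bsup>y/\<tau>\<^esup> C\<^sup>y\<close> are contractions.\<close>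

lemma heinz_contraction:
  assumes A: "A \<in> psd_mats n" and C: "C \<in> psd_mats n" and AC: "opnorm_le n (A * C \<^bold>^ (x + y)) 1"
    and xy: "0 \<le> x" "0 \<le> y" "0 < x + y"
  shows "opnorm_le n (C \<^bold>^ x * A * C \<^bold>^ y) 1"
proof -
  note Ap = psd_matsD[OF psd_powr[OF A]] and Cp = psd_matsD[OF psd_powr[OF C]]
  have AC': "opnorm_le n (A \<^bold>^ 1 * C \<^bold>^ (x + y)) 1" using AC by (simp add: mat_powr_one[OF A])
  have 1: "opnorm_le n (A \<^bold>^ (x / (x + y)) * C \<^bold>^ x) 1"
    by (rule cordes_inequality_powr[OF A C AC', of "x / (x + y)"]) (use xy in auto)
  have 2: "opnorm_le n (A \<^bold>^ (y / (x + y)) * C \<^bold>^ y) 1"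
    by (rule cordes_inequality_powr[OF A C AC', of "y / (x + y)"]) (use xy in auto)
  have "x / (x + y) + y / (x + y) = 1" using xy by (simp flip: add_divide_distrib)
  then have "C \<^bold>^ x * A * C \<^bold>^ y = (A \<^bold>^ (x / (x + y)) * C \<^bold>^ x)\<^sup>\<dagger> * (A \<^bold>^ (y / (x + y)) * C \<^bold>^ y)"
    using Ap Cp psd_matsD[OF A]
    by (simp add: adjoint_mult mat_assoc mat_powr_add_left[OF A] mat_powr_one[OF A])
  moreover have "opnorm_le n ((A \<^bold>^ (x / (x + y)) * C \<^bold>^ x)\<^sup>\<dagger> * (A \<^bold>^ (y / (x + y)) * C \<^bold>^ y)) (1 * 1)"
    using 1 2 Ap Cp by (intro opnorm_le_mult opnorm_le_adjoint) auto
  ultimately show ?thesis by simp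
qed

text \<open>With \<open>T = Y\<^bsup>1/2\<^esup> X\<^bsup>1/2\<^esup>\<close>, \<open>M = T T\<^sup>\<dagger>\<close> and \<open>N = T\<^sup>\<dagger> T\<close>, the intertwining relation
  \<open>M\<^bsup>\<alpha>-1\<^esup> T = T N\<^bsup>\<alpha>-1\<^esup>\<close> shows that \<open>Y\<^bsup>-1/2\<^esup> M\<^sup>\<alpha> Y\<^bsup>-1/2\<^esup> = X\<^bsup>1/2\<^esup> N\<^bsup>\<alpha>-1\<^esup> X\<^bsup>1/2\<^esup>\<close>. So the hypothesis
  says that \<open>X\<^bsup>1/2\<^esup> N\<^bsup>(\<alpha>-1)/2\<^esup>\<close> is a contraction. The Cordes inequality with exponent
  \<open>1/(\<alpha> - 1) \<le> 1\<close> makes the power of \<open>N\<close> equal to \<open>1/2\<close>, and then \<open>N = X\<^bsup>1/2\<^esup> Y X\<^bsup>1/2\<^esup>\<close> can be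
  inserted.\<close>

lemma perspective_contraction_imp:
  assumes X: "X \<in> psd_mats n" and Y: "Y \<in> pd_mats n" and \<alpha>: "2 \<le> \<alpha>"
    and le: "opnorm_le n (Y \<^bold>^ (- (1/2)) * (Y \<^bold>^ (1/2) * X * Y \<^bold>^ (1/2)) \<^bold>^ (\<alpha> / 2)) 1"
  shows "opnorm_le n (X \<^bold>^ (\<alpha> / (2 * (\<alpha> - 1))) * Y \<^bold>^ (1/2)) 1"
proof -
  note Y' = pd_imp_psd[OF Y]
  note Xp = psd_matsD[OF psd_powr[OF X]] and Yp = psd_matsD[OF psd_powr[OF Y']]
  define T where "T = Y \<^bold>^ (1/2) * X \<^bold>^ (1/2)"
  have T: "T \<in> carrier_mat n n" unfolding T_def using Yp(1) Xp(1) by (rule mult_carrier_mat)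
  then have Td: "dim_row T = n" "dim_col T = n" by auto
  have T': "T\<^sup>\<dagger> = X \<^bold>^ (1/2) * Y \<^bold>^ (1/2)" unfolding T_def using Xp Yp by (simp add: adjoint_mult)
  define M N where "M = T * T\<^sup>\<dagger>" and "N = T\<^sup>\<dagger> * T"
  have M: "M \<in> psd_mats n" and N: "N \<in> psd_mats n"
    unfolding M_def N_def using psd_mult_adjoint[OF T] psd_adjoint_mult[OF T] by auto
  note Mp = psd_matsD[OF psd_powr[OF M]] and Np = psd_matsD[OF psd_powr[OF N]]
  have TM: "M = Y \<^bold>^ (1/2) * X * Y \<^bold>^ (1/2)"
    unfolding M_def T' unfolding T_def using Xp Yp psd_matsD[OF X]
    by (simp add: mat_assoc mat_powr_add_left[OF X] mat_powr_one[OF X])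
  have TN: "N = X \<^bold>^ (1/2) * Y * X \<^bold>^ (1/2)"
    unfolding N_def T' unfolding T_def using Xp Yp psd_matsD[OF Y']
    by (simp add: mat_assoc mat_powr_add_left[OF Y'] mat_powr_one[OF Y'])
  let ?S = "Y \<^bold>^ (- (1/2)) * M \<^bold>^ (\<alpha> / 2)" and ?R = "X \<^bold>^ (1/2) * N \<^bold>^ ((\<alpha> - 1) / 2)"
  have inv: "Y \<^bold>^ (- (1/2)) * T = X \<^bold>^ (1/2)"
    unfolding T_def using Xp Yp by (simp add: mat_powr_add_left[OF Y'] mat_powr_zero[OF Y])
  have "?S * ?S\<^sup>\<dagger> = Y \<^bold>^ (- (1/2)) * (M \<^bold>^ \<alpha> * Y \<^bold>^ (- (1/2)))"
    using Mp Yp by (simp add: adjoint_mult mat_assoc mat_powr_add_left[OF M])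
  also have "M \<^bold>^ \<alpha> = M \<^bold>^ (\<alpha> - 1) * M"
    using mat_powr_add[OF M, of "\<alpha> - 1" 1] unfolding mat_powr_one[OF M] by simp
  also have "\<dots> = M \<^bold>^ (\<alpha> - 1) * T * T\<^sup>\<dagger>"
    unfolding M_def using Td Mp by (simp add: mat_assoc M_def)
  also have "M \<^bold>^ (\<alpha> - 1) * T = T * N \<^bold>^ (\<alpha> - 1)"
    unfolding M_def N_def mat_powr_intertwine[OF T] ..
  also have "Y \<^bold>^ (- (1/2)) * (T * N \<^bold>^ (\<alpha> - 1) * T\<^sup>\<dagger> * Y \<^bold>^ (- (1/2)))
      = (Y \<^bold>^ (- (1/2)) * T) * N \<^bold>^ (\<alpha> - 1) * (Y \<^bold>^ (- (1/2)) * T)\<^sup>\<dagger>"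
    using Xp Yp Np Td by (simp add: adjoint_mult mat_assoc)
  also have "\<dots> = ?R * ?R\<^sup>\<dagger>"
    unfolding inv using Xp Np by (simp add: adjoint_mult mat_assoc mat_powr_add_left[OF N])
  finally have SR: "?S * ?S\<^sup>\<dagger> = ?R * ?R\<^sup>\<dagger>" .
  have "opnorm_le n ?R 1"
    by (rule opnorm_le_cong_square[OF _ _ SR]) (use le TM Xp Yp Np Mp in auto)
  then have V: "opnorm_le n (X \<^bold>^ (1 / (2 * (\<alpha> - 1))) * N \<^bold>^ (1/2)) 1"
    by (rule cordes_inequality_powr[OF X N, of _ _ "1 / (\<alpha> - 1)"]) (use \<alpha> in auto)
  define p q where "p = 1 / (2 * (\<alpha> - 1))" and "q = \<alpha> / (2 * (\<alpha> - 1))"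
  have pq: "p + 1/2 = q" using \<alpha> by (simp add: field_simps p_def q_def)
  have "opnorm_le n (X \<^bold>^ q * Y \<^bold>^ (1/2)) 1"
  proof (rule opnorm_le_cong_square[OF _ _ _ _ V[folded p_def]])
    let ?V = "X \<^bold>^ p * N \<^bold>^ (1/2)" and ?W = "X \<^bold>^ q * Y \<^bold>^ (1/2)"
    have "?V * ?V\<^sup>\<dagger> = X \<^bold>^ p * (N * X \<^bold>^ p)"
      using Xp Np by (simp add: adjoint_mult mat_assoc mat_powr_add_left[OF N] mat_powr_one[OF N])
    also have "\<dots> = X \<^bold>^ q * (Y * X \<^bold>^ q)"
      unfolding TN using Xp psd_matsD[OF Y'] pq
      by (simp add: mat_assoc mat_powr_add_left[OF X] mat_powr_add[OF X] add.commute[of "1/2"])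
    also have "\<dots> = ?W * ?W\<^sup>\<dagger>"
      using Xp Yp psd_matsD[OF Y']
      by (simp add: adjoint_mult mat_assoc mat_powr_add_left[OF Y'] mat_powr_one[OF Y'])
    finally show "?V * ?V\<^sup>\<dagger> = ?W * ?W\<^sup>\<dagger>" .
  qed (use Xp Yp Np in auto)
  then show ?thesis by (simp add: q_def)
qed

text \<open>Let \<open>M = C\<^bsup>1/2\<^esup> A C\<^bsup>1/2\<^esup>\<close>. The claim is the case \<open>\<beta> = \<alpha>\<close> of
  \<open>G(\<beta>)\<close>: \<open>C\<^bsup>-\<beta>/(2\<alpha>)\<^esup> M\<^bsup>\<beta>/2\<^esup>\<close> is a contraction. \<open>G(\<beta>)\<close> implies \<open>G(\<beta> + 2)\<close>, because one more
  factor \<open>M\<close> inserts a factor \<open>C\<^sup>x A C\<^sup>y\<close> with \<open>x + y = (\<alpha> - 1)/\<alpha>\<close>, a contraction by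
  \<open>heinz_contraction\<close>; the condition \<open>\<beta> + 2 \<le> \<alpha>\<close> is \<open>x \<ge> 0\<close>. Starting from \<open>G(0)\<close> this gives
  \<open>G(2)\<close>, here \<open>\<alpha> \<ge> 2\<close> is needed; \<open>G(\<beta>)\<close> for \<open>0 \<le> \<beta> \<le> 2\<close> follows by the Cordes inequality, and steps
  of length \<open>2\<close> lead to \<open>\<alpha>\<close>.\<close>

lemma perspective_contraction:
  assumes A: "A \<in> psd_mats n" and C: "C \<in> pd_mats n" and \<alpha>: "2 \<le> \<alpha>"
    and le: "opnorm_le n (A * C \<^bold>^ ((\<alpha> - 1) / \<alpha>)) 1"
  shows "opnorm_le n (C \<^bold>^ (- (1/2)) * (C \<^bold>^ (1/2) * A * C \<^bold>^ (1/2)) \<^bold>^ (\<alpha> / 2)) 1"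
proof -
  note C' = pd_imp_psd[OF C]
  note Ad = psd_matsD[OF A] and Cp = psd_matsD[OF psd_powr[OF C']]
  define M where "M = C \<^bold>^ (1/2) * A * C \<^bold>^ (1/2)"
  have "M = (A \<^bold>^ (1/2) * C \<^bold>^ (1/2))\<^sup>\<dagger> * (A \<^bold>^ (1/2) * C \<^bold>^ (1/2))"
    unfolding M_def using Ad Cp psd_matsD[OF psd_powr[OF A]]
    by (simp add: adjoint_mult mat_assoc mat_powr_add_left[OF A] mat_powr_one[OF A])
  then have M: "M \<in> psd_mats n"
    using psd_adjoint_mult[OF mult_carrier_mat[OF psd_matsD(1)[OF psd_powr[OF A]] Cp(1)]] by simp
  note Mp = psd_matsD[OF psd_powr[OF M]]
  define G where "G \<beta> \<longleftrightarrow> opnorm_le n (C \<^bold>^ (- (\<beta> / (2 * \<alpha>))) * M \<^bold>^ (\<beta> / 2)) 1" for \<beta>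
  have step: "G (\<beta> + 2)" if \<beta>: "0 \<le> \<beta>" "\<beta> + 2 \<le> \<alpha>" and "G \<beta>" for \<beta>
  proof -
    \<comment> \<open>the exponents that remain next to \<open>A\<close> when \<open>C\<^bsup>-(\<beta>+2)/(2\<alpha>)\<^esup> M C\<^bsup>\<beta>/(2\<alpha>)\<^esup>\<close> is multiplied out\<close>
    define x where "x = 1/2 - (\<beta> + 2) / (2 * \<alpha>)"
    define y where "y = 1/2 + \<beta> / (2 * \<alpha>)"
    have xy: "0 \<le> x" "0 \<le> y" "0 < x + y" "x + y = (\<alpha> - 1) / \<alpha>"
      using \<alpha> \<beta> by (auto simp: x_def y_def field_simps)
    have "opnorm_le n (C \<^bold>^ x * A * C \<^bold>^ y) 1"
      by (rule heinz_contraction[OF A C' _ xy(1,2,3)]) (use le xy in simp)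
    then have "opnorm_le n ((C \<^bold>^ x * A * C \<^bold>^ y) * (C \<^bold>^ (- (\<beta> / (2 * \<alpha>))) * M \<^bold>^ (\<beta> / 2))) (1 * 1)"
      using \<open>G \<beta>\<close> Ad Cp Mp by (intro opnorm_le_mult) (auto simp: G_def)
    moreover have "(C \<^bold>^ x * A * C \<^bold>^ y) * (C \<^bold>^ (- (\<beta> / (2 * \<alpha>))) * M \<^bold>^ (\<beta> / 2))
        = C \<^bold>^ (- ((\<beta> + 2) / (2 * \<alpha>))) * (M * M \<^bold>^ (\<beta> / 2))"
      unfolding M_def using Ad Cp Mp[unfolded M_def]
      by (simp add: mat_assoc mat_powr_add_left[OF C'] x_def y_def)
    moreover have "M * M \<^bold>^ (\<beta> / 2) = M \<^bold>^ ((\<beta> + 2) / 2)"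
      using mat_powr_add[OF M, of 1 "\<beta> / 2"] by (simp add: mat_powr_one[OF M] add_divide_distrib add.commute)
    ultimately show ?thesis by (simp add: G_def)
  qed
  have "G 0"
  proof -
    obtain U d where U: "U \<in> unitary_mats n" and d: "M = U * real_diag n d * U\<^sup>\<dagger>"
      using psd_diagonalization[OF M] by metis
    have "opnorm_le n (M \<^bold>^ 0) 1" unfolding d mat_powr_eq[OF U] opnorm_le_conj_diag[OF U zero_le_one] by simp
    then show ?thesis using Mp by (simp add: G_def mat_powr_zero[OF C])
  qed
  then have G2: "G 2" using step[of 0] \<alpha> by simp
  have base: "G \<beta>" if "0 \<le> \<beta>" "\<beta> \<le> 2" for \<beta>
    unfolding G_def
    by (rule cordes_inequality_powr[OF C' M G2[unfolded G_def], of "\<beta> / 2"]) (use that in auto)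
  have even_steps: "G (\<beta> + 2 * real k)" if "0 \<le> \<beta>" "\<beta> \<le> 2" "\<beta> + 2 * real k \<le> \<alpha>" for k \<beta>
    using that(3)
  proof (induction k)
    case 0 then show ?case using base that by simp
  next
    case (Suc k)
    then have "G (\<beta> + 2 * real k + 2)" by (intro step) (use that in auto)
    then show ?case by (simp add: algebra_simps)
  qed
  define k where "k = nat \<lfloor>\<alpha> / 2\<rfloor>"
  have "0 \<le> \<alpha> - 2 * real k" "\<alpha> - 2 * real k \<le> 2"
    using \<alpha> unfolding k_def by linarith+
  then have "G \<alpha>" using even_steps[of "\<alpha> - 2 * real k" k] by simp
  then show ?thesis using \<alpha> by (simp add: G_def M_def)
qed

text \<open>The powers in \<open>P_mat\<close> are taken of positive semidefinite matrices only, so the calculus of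
  the preceding lemmas applies at every level.\<close>

lemma P_mat_psd_form:
  fixes \<alpha> r :: real
  assumes A: "A \<in> psd_mats n" and B: "B \<in> pd_mats n" and r: "r > 0"
  defines "N \<equiv> B \<^bold>^ (- (1 / (2 * r))) * A \<^bold>^ (1 / r) * B \<^bold>^ (- (1 / (2 * r)))"
    and "P \<equiv> B \<^bold>^ (1 / (2 * r)) * (B \<^bold>^ (- (1 / (2 * r))) * A \<^bold>^ (1 / r) * B \<^bold>^ (- (1 / (2 * r)))) \<^bold>^ \<alpha> * B \<^bold>^ (1 / (2 * r))"
  shows "N \<in> psd_mats n" "P = (B \<^bold>^ (1 / (2 * r)) * N \<^bold>^ (\<alpha> / 2)) * (B \<^bold>^ (1 / (2 * r)) * N \<^bold>^ (\<alpha> / 2))\<^sup>\<dagger>"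
    "P \<in> psd_mats n"
proof -
  note B' = pd_imp_psd[OF B]
  note Ap = psd_matsD[OF psd_powr[OF A]] and Bp = psd_matsD[OF psd_powr[OF B']]
  let ?R = "A \<^bold>^ (1 / (2 * r)) * B \<^bold>^ (- (1 / (2 * r)))"
  have "1 / (2 * r) + 1 / (2 * r) = 1 / r" using r by (simp add: field_simps)
  then have "N = ?R\<^sup>\<dagger> * ?R"
    unfolding N_def using Ap Bp by (simp add: adjoint_mult mat_assoc mat_powr_add_left[OF A])
  then show N: "N \<in> psd_mats n"
    using psd_adjoint_mult[OF mult_carrier_mat[OF Ap(1) Bp(1)]] by simp
  note Np = psd_matsD[OF psd_powr[OF N]]
  show P: "P = (B \<^bold>^ (1 / (2 * r)) * N \<^bold>^ (\<alpha> / 2)) * (B \<^bold>^ (1 / (2 * r)) * N \<^bold>^ (\<alpha> / 2))\<^sup>\<dagger>"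
    unfolding P_def N_def[symmetric] using Bp Np
    by (simp add: adjoint_mult mat_assoc mat_powr_add_left[OF N])
  then show "P \<in> psd_mats n" using psd_mult_adjoint[OF mult_carrier_mat[OF Bp(1) Np(1)]] by simp
qed

lemma P_mat_psd: "A \<in> psd_mats n \<Longrightarrow> B \<in> pd_mats n \<Longrightarrow> r > 0 \<Longrightarrow> P_mat \<alpha> r A B \<in> psd_mats n"
  unfolding P_mat_def by (intro psd_powr P_mat_psd_form(3))

lemma opnorm_P_mat:
  assumes A: "A \<in> psd_mats n" and B: "B \<in> pd_mats n" and r: "r > 0"
  shows "opnorm_le n (P_mat \<alpha> r A B) 1 \<longleftrightarrow>
    opnorm_le n (B \<^bold>^ (1 / (2 * r)) *
      (B \<^bold>^ (- (1 / (2 * r))) * A \<^bold>^ (1 / r) * B \<^bold>^ (- (1 / (2 * r)))) \<^bold>^ (\<alpha> / 2)) 1"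
    (is "_ \<longleftrightarrow> opnorm_le n ?S 1")
proof -
  note psd = P_mat_psd_form[OF A B r]
  have S: "?S \<in> carrier_mat n n"
    using psd_matsD(1)[OF psd_powr[OF pd_imp_psd[OF B]]] psd_matsD(1)[OF psd_powr[OF psd(1)]]
    by (rule mult_carrier_mat)
  have "opnorm_le n (P_mat \<alpha> r A B) 1 \<longleftrightarrow> opnorm_le n (?S * ?S\<^sup>\<dagger>) 1"
    unfolding P_mat_def opnorm_le_powr[OF psd(3) r] unfolding psd(2) ..
  also have "\<dots> \<longleftrightarrow> opnorm_le n (?S\<^sup>\<dagger>) 1"
    using opnorm_le_self_adjoint_square[OF mat_adjoint_carrier[OF S] zero_le_one] by simp
  also have "\<dots> \<longleftrightarrow> opnorm_le n ?S 1"
    using opnorm_le_adjoint[OF S zero_le_one] opnorm_le_adjoint[OF mat_adjoint_carrier[OF S] zero_le_one] by auto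
  finally show ?thesis .
qed

text \<open>With \<open>X = A\<^bsup>1/r'\<^esup>\<close>, \<open>Y = B\<^bsup>-1/r'\<^esup>\<close>, \<open>s = r'/r\<close> and \<open>\<tau> = (\<alpha> - 1)/\<alpha>\<close>, the matrices for \<open>r\<close> are
  \<open>X\<^sup>s\<close> and \<open>Y\<^sup>s\<close>. The hypothesis gives \<open>\<parallel>X\<^bsup>1/(2\<tau>)\<^esup> Y\<^bsup>1/2\<^esup>\<parallel> \<le> 1\<close>, the Cordes inequality with exponent
  \<open>2\<tau>s\<close> turns this into \<open>\<parallel>X\<^sup>s (Y\<^sup>s)\<^sup>\<tau>\<parallel> \<le> 1\<close>, and this implies the conclusion. The assumption on
  \<open>r'\<close> says precisely that \<open>2\<tau>s \<le> 1\<close>.\<close>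

lemma P_mat_contraction_mono:
  assumes A: "A \<in> psd_mats n" and B: "B \<in> pd_mats n" and \<alpha>: "2 \<le> \<alpha>"
    and r: "0 < r" "0 < r'" and rr: "r' \<le> \<alpha> / (2 * (\<alpha> - 1)) * r"
    and le: "opnorm_le n (P_mat \<alpha> r' A B) 1"
  shows "opnorm_le n (P_mat \<alpha> r A B) 1"
proof -
  note B' = pd_imp_psd[OF B]
  define X Y where "X = A \<^bold>^ (1 / r')" and "Y = B \<^bold>^ (- (1 / r'))"
  define s where "s = r' / r"
  have s: "0 < s" "2 * ((\<alpha> - 1) / \<alpha>) * s \<le> 1"
    using r rr \<alpha> by (auto simp: s_def field_simps)
  have X: "X \<in> psd_mats n" unfolding X_def by (rule psd_powr[OF A])
  have Y: "Y \<in> pd_mats n" unfolding Y_def by (rule pd_powr[OF B])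
  note Y' = pd_imp_psd[OF Y]
  have [simp]: "B \<^bold>^ (1 / (2 * r')) = Y \<^bold>^ (- (1/2))" "B \<^bold>^ (- (1 / (2 * r'))) = Y \<^bold>^ (1/2)"
    by (simp_all add: Y_def mat_powr_powr[OF B'] mult.commute)
  have "opnorm_le n (X \<^bold>^ (\<alpha> / (2 * (\<alpha> - 1))) * Y \<^bold>^ (1/2)) 1"
    using le unfolding opnorm_P_mat[OF A B r(2)]
    by (intro perspective_contraction_imp[OF X Y \<alpha>]) (simp add: X_def[symmetric])
  then have "opnorm_le n (X \<^bold>^ s * Y \<^bold>^ (s * ((\<alpha> - 1) / \<alpha>))) 1"
    by (rule cordes_inequality_powr[OF X Y', of _ _ "2 * ((\<alpha> - 1) / \<alpha>) * s"])
      (use s \<alpha> in \<open>auto simp: field_simps\<close>)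
  then have "opnorm_le n (X \<^bold>^ s * (Y \<^bold>^ s) \<^bold>^ ((\<alpha> - 1) / \<alpha>)) 1"
    by (simp add: mat_powr_powr[OF Y'])
  then have *: "opnorm_le n ((Y \<^bold>^ s) \<^bold>^ (- (1/2)) *
      ((Y \<^bold>^ s) \<^bold>^ (1/2) * X \<^bold>^ s * (Y \<^bold>^ s) \<^bold>^ (1/2)) \<^bold>^ (\<alpha> / 2)) 1"
    by (rule perspective_contraction[OF psd_powr[OF X] pd_powr[OF Y] \<alpha>])
  have "(Y \<^bold>^ s) \<^bold>^ (- (1/2)) = B \<^bold>^ (1 / (2 * r))" "(Y \<^bold>^ s) \<^bold>^ (1/2) = B \<^bold>^ (- (1 / (2 * r)))"
    "X \<^bold>^ s = A \<^bold>^ (1 / r)"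
    using r unfolding Y_def X_def s_def by (simp_all add: mat_powr_powr[OF B'] mat_powr_powr[OF A] field_simps)
  then show ?thesis using * unfolding opnorm_P_mat[OF A B r(1)] by simp
qed

section \<open>Homogeneity and the norm inequality\<close>

lemma mat_powr_smult:
  assumes X: "X \<in> psd_mats n" and c: "0 < c"
  shows "(of_real c \<cdot>\<^sub>m X) \<^bold>^ p = of_real (c powr p) \<cdot>\<^sub>m X \<^bold>^ p" "of_real c \<cdot>\<^sub>m X \<in> psd_mats n"
proof -
  obtain U d where U: "U \<in> unitary_mats n" and d: "\<forall>i. 0 \<le> d i" and X: "X = U * real_diag n d * U\<^sup>\<dagger>"
    using psd_diagonalization[OF X] .
  have sm: "of_real a \<cdot>\<^sub>m (U * real_diag n e * U\<^sup>\<dagger>) = U * real_diag n (\<lambda>i. a * e i) * U\<^sup>\<dagger>" for a e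
  proof -
    have "real_diag n (\<lambda>i. a * e i) = of_real a \<cdot>\<^sub>m real_diag n e" by (rule eq_matI) auto
    then show ?thesis using unitaryD[OF U] real_diag_carrier[of n e]
      by (simp add: mult_smult_distrib[of _ n n _ n] mult_smult_assoc_mat[of _ n n _ n] mat_adjoint_carrier)
  qed
  show "(of_real c \<cdot>\<^sub>m X) \<^bold>^ p = of_real (c powr p) \<cdot>\<^sub>m X \<^bold>^ p"
    unfolding X sm mat_powr_eq[OF U] using d c by (simp add: powr_mult)
  show "of_real c \<cdot>\<^sub>m X \<in> psd_mats n"
    unfolding X sm using d c by (intro psd_conj_diag[OF U]) auto
qed

lemma P_mat_smult:
  assumes A: "A \<in> psd_mats n" and B: "B \<in> pd_mats n" and r: "r > 0" and c: "0 < c"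
  shows "P_mat \<alpha> r (of_real c \<cdot>\<^sub>m A) B = of_real (c powr \<alpha>) \<cdot>\<^sub>m P_mat \<alpha> r A B"
proof -
  note B' = pd_imp_psd[OF B]
  note Ap = psd_matsD(1)[OF psd_powr[OF A]] and Bp = psd_matsD(1)[OF psd_powr[OF B']]
  note psd = P_mat_psd_form[OF A B r]
  have sm: "Z * (a \<cdot>\<^sub>m X) * Z = a \<cdot>\<^sub>m (Z * X * Z)"
    if "Z \<in> carrier_mat n n" "X \<in> carrier_mat n n" for Z X :: "complex mat" and a
    using that by (simp add: mult_smult_distrib[of _ n n _ n] mult_smult_assoc_mat[of _ n n _ n] mult_carrier_mat[of _ n n _ n])
  show ?thesis
    unfolding P_mat_def mat_powr_smult(1)[OF A c] sm[OF Bp Ap]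
      mat_powr_smult(1)[OF psd(1) powr_gt_zero[THEN iffD2, OF c[THEN less_imp_neq, symmetric]]]
      sm[OF Bp psd_matsD(1)[OF psd_powr[OF psd(1)]]]
    using c r by (subst mat_powr_smult(1)[OF psd(3)]) (simp_all add: powr_powr)
qed

lemma opnorm_le_smult:
  assumes "T \<in> carrier_mat n n" "0 < a"
  shows "opnorm_le n (of_real a \<cdot>\<^sub>m T) (a * c) \<longleftrightarrow> opnorm_le n T c"
proof -
  have "(of_real a \<cdot>\<^sub>m T) *\<^sub>v v = of_real a \<cdot>\<^sub>v (T *\<^sub>v v)" if "v \<in> carrier_vec n" for v
    using assms that by (intro eq_vecI) auto
  then show ?thesis using assms
    by (auto simp: opnorm_le_def sqnorm_smult power_mult_distrib mult.assoc)
qed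

text \<open>Both norms are homogeneous of degree \<open>\<alpha>\<close> in \<open>A\<close>, so the bound \<open>c\<close> can be scaled to \<open>1\<close>.\<close>

lemma P_mat_opnorm_mono:
  assumes A: "A \<in> psd_mats n" and B: "B \<in> pd_mats n" and \<alpha>: "2 \<le> \<alpha>"
    and r: "0 < r" "0 < r'" and rr: "r' \<le> \<alpha> / (2 * (\<alpha> - 1)) * r"
    and c: "0 < c" and le: "opnorm_le n (P_mat \<alpha> r' A B) c"
  shows "opnorm_le n (P_mat \<alpha> r A B) c"
proof -
  define a where "a = c powr (- (1 / \<alpha>))"
  have "a powr \<alpha> = c powr (- (1 / \<alpha>) * \<alpha>)" unfolding a_def by (rule powr_powr)
  then have a: "0 < a" "a powr \<alpha> = 1 / c" using c \<alpha> by (auto simp: a_def powr_minus_divide)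
  have *: "opnorm_le n (P_mat \<alpha> q (of_real a \<cdot>\<^sub>m A) B) 1 \<longleftrightarrow> opnorm_le n (P_mat \<alpha> q A B) c" if "q > 0" for q
    using opnorm_le_smult[OF psd_matsD(1)[OF P_mat_psd[OF A B that]], of "1 / c" \<alpha> c] c
    by (simp add: P_mat_smult[OF A B that a(1)] a(2))
  show ?thesis
    using P_mat_contraction_mono[OF mat_powr_smult(2)[OF A a(1)] B \<alpha> r rr] le *[OF r(1)] *[OF r(2)] by simp
qed

section \<open>Compound matrices\<close>

text \<open>An arbitrary but fixed enumeration: it only serves to index rows and columns of compound
  matrices by numbers.\<close>

definition ksubsets :: "nat \<Rightarrow> nat \<Rightarrow> nat set list" where
  "ksubsets n k = (SOME L. distinct L \<and> set L = {S. S \<subseteq> {..<n} \<and> card S = k})"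

lemma ksubsets: "distinct (ksubsets n k)" "set (ksubsets n k) = {S. S \<subseteq> {..<n} \<and> card S = k}"
proof -
  have "finite {S. S \<subseteq> {..<n} \<and> card S = k}" by (rule finite_subset[of _ "Pow {..<n}"]) auto
  then have "\<exists>L. distinct L \<and> set L = {S. S \<subseteq> {..<n} \<and> card S = k}"
    using finite_distinct_list by metis
  from someI_ex[OF this]
  show "distinct (ksubsets n k)" "set (ksubsets n k) = {S. S \<subseteq> {..<n} \<and> card S = k}"
    by (auto simp: ksubsets_def)
qed

abbreviation enum :: "nat set \<Rightarrow> nat \<Rightarrow> nat" where
  "enum S a \<equiv> sorted_list_of_set S ! a"

lemma bij_betw_enum:
  assumes "S \<subseteq> {..<n}" "card S = k"
  shows "bij_betw (enum S) {0..<k} S"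
proof -
  have "finite S" using assms(1) finite_subset by blast
  then show ?thesis using assms(2)
    by (intro bij_betw_nth) (auto simp: lessThan_atLeast0)
qed

lemma enum_less:
  assumes "S \<subseteq> {..<n}" "card S = k" "a < k"
  shows "enum S a < n"
  using bij_betwE[OF bij_betw_enum[OF assms(1,2)]] assms by auto

text \<open>Expand the entries of the product in the Leibniz formula: this gives a sum over all maps \<open>g\<close>
  from row positions to \<open>{..<n}\<close> of \<open>\<Prod>\<^sub>i a i (g i)\<close> times a determinant with rows \<open>b (g i)\<close>.
  Maps that are not injective contribute \<open>0\<close>. The injective maps with image \<open>R\<close> are the
  rearrangements of the increasing enumeration of \<open>R\<close>, and the signs of the rearrangements
  assemble the determinant of the \<open>a\<close>-part.\<close>

lemma cauchy_binet:
  fixes a b :: "nat \<Rightarrow> nat \<Rightarrow> complex"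
  shows "det (mat k k (\<lambda>(i, l). \<Sum>j<n. a i j * b j l)) =
    (\<Sum>R | R \<subseteq> {..<n} \<and> card R = k.
      det (mat k k (\<lambda>(i, l). a i (enum R l))) * det (mat k k (\<lambda>(i, l). b (enum R i) l)))"
proof -
  let ?I = "{0..<k}"
  let ?B = "\<lambda>g. mat k k (\<lambda>(i, l). b (g i) l)"
  let ?h = "\<lambda>g. (\<Prod>i\<in>?I. a i (g i)) * det (?B g)"
  let ?G = "{g \<in> ?I \<rightarrow>\<^sub>E {..<n}. inj_on g ?I}"
  let ?K = "{R. R \<subseteq> {..<n} \<and> card R = k}"
  have "det (mat k k (\<lambda>(i, l). \<Sum>j<n. a i j * b j l)) =
      (\<Sum>\<sigma> | \<sigma> permutes ?I. signof \<sigma> * (\<Prod>i\<in>?I. \<Sum>j<n. a i j * b j (\<sigma> i)))"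
    by (subst det_def'[of _ k]) (auto simp: permutes_in_image intro!: sum.cong prod.cong)
  also have "\<dots> = (\<Sum>\<sigma> | \<sigma> permutes ?I. \<Sum>g \<in> ?I \<rightarrow>\<^sub>E {..<n}.
      (\<Prod>i\<in>?I. a i (g i)) * (signof \<sigma> * (\<Prod>i\<in>?I. b (g i) (\<sigma> i))))"
    by (simp add: prod_sum_PiE prod.distrib sum_distrib_left mult.left_commute)
  also have "\<dots> = (\<Sum>g \<in> ?I \<rightarrow>\<^sub>E {..<n}. (\<Prod>i\<in>?I. a i (g i)) *
      (\<Sum>\<sigma> | \<sigma> permutes ?I. signof \<sigma> * (\<Prod>i\<in>?I. b (g i) (\<sigma> i))))"
    by (subst sum.swap) (simp add: sum_distrib_left)
  also have "\<dots> = sum ?h (?I \<rightarrow>\<^sub>E {..<n})"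
    by (intro sum.cong arg_cong2[of _ _ _ _ "(*)"] refl, subst det_def'[of _ k])
      (auto simp: permutes_in_image intro!: sum.cong prod.cong)
  also have "\<dots> = sum ?h ?G"
  proof (rule sum.mono_neutral_right)
    show "\<forall>g \<in> (?I \<rightarrow>\<^sub>E {..<n}) - ?G. ?h g = 0"
    proof
      fix g assume "g \<in> (?I \<rightarrow>\<^sub>E {..<n}) - ?G"
      then obtain i j where ij: "i < k" "j < k" "i \<noteq> j" "g i = g j" by (auto simp: inj_on_def)
      have "row (?B g) i = row (?B g) j" by (rule eq_vecI) (use ij in auto)
      then have "det (?B g) = 0" using ij by (intro det_identical_rows[of _ k i j]) auto
      then show "?h g = 0" by simp
    qed
  qed (auto intro: finite_PiE)
  also have "\<dots> = (\<Sum>R\<in>?K. sum ?h {g \<in> ?G. g ` ?I = R})"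
  proof (rule sum.group[symmetric])
    show "finite ?G" by (auto intro: finite_subset[OF _ finite_PiE[of ?I "\<lambda>_. {..<n}"]])
    show "finite ?K" by (rule finite_subset[of _ "Pow {..<n}"]) auto
    show "(\<lambda>g. g ` ?I) ` ?G \<subseteq> ?K" by (auto simp: card_image)
  qed
  also have "\<dots> = (\<Sum>R\<in>?K. det (mat k k (\<lambda>(i, l). a i (enum R l))) * det (?B (enum R)))"
  proof (rule sum.cong[OF refl])
    fix R assume "R \<in> ?K"
    then have R: "R \<subseteq> {..<n}" "card R = k" by auto
    note bij = bij_betw_enum[OF R]
    let ?r = "\<lambda>\<pi>. restrict (\<lambda>i. enum R (\<pi> i)) ?I"
    have "bij_betw ?r {\<pi>. \<pi> permutes ?I} {g \<in> ?G. g ` ?I = R}"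
    proof (rule bij_betw_byWitness[where f' = "\<lambda>g i. if i \<in> ?I then inv_into ?I (enum R) (g i) else i"])
      show "\<forall>\<pi> \<in> {\<pi>. \<pi> permutes ?I}. (\<lambda>i. if i \<in> ?I then inv_into ?I (enum R) (?r \<pi> i) else i) = \<pi>"
      proof (intro ballI ext)
        fix \<pi> i assume "\<pi> \<in> {\<pi>. \<pi> permutes ?I}"
        then have \<pi>: "\<pi> permutes ?I" by simp
        then show "(if i \<in> ?I then inv_into ?I (enum R) (?r \<pi> i) else i) = \<pi> i"
          using bij_betw_imp_inj_on[OF bij] permutes_in_image[OF \<pi>, of i] permutes_not_in[OF \<pi>, of i]
          by (simp add: inv_into_f_f)
      qed
      show "\<forall>g \<in> {g \<in> ?G. g ` ?I = R}. ?r (\<lambda>i. if i \<in> ?I then inv_into ?I (enum R) (g i) else i) = g"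
      proof (intro ballI ext)
        fix g i assume g: "g \<in> {g \<in> ?G. g ` ?I = R}"
        show "?r (\<lambda>i. if i \<in> ?I then inv_into ?I (enum R) (g i) else i) i = g i"
        proof (cases "i \<in> ?I")
          case True
          then have "g i \<in> enum R ` ?I" using g bij_betw_imp_surj_on[OF bij] by auto
          then show ?thesis using True by (simp add: f_inv_into_f)
        next
          case False
          then show ?thesis using g by (auto simp: PiE_arb[of g ?I])
        qed
      qed
      show "?r ` {\<pi>. \<pi> permutes ?I} \<subseteq> {g \<in> ?G. g ` ?I = R}"
      proof
        fix g assume "g \<in> ?r ` {\<pi>. \<pi> permutes ?I}"
        then obtain \<pi> where \<pi>: "\<pi> permutes ?I" and g: "g = ?r \<pi>" by auto
        have b: "bij_betw (enum R \<circ> \<pi>) ?I R" using permutes_imp_bij[OF \<pi>] bij by (rule bij_betw_trans)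
        have "bij_betw g ?I R" using b by (rule bij_betw_cong[THEN iffD1, rotated]) (auto simp: g)
        then show "g \<in> {g \<in> ?G. g ` ?I = R}" using R by (auto simp: bij_betw_def g)
      qed
      show "(\<lambda>g i. if i \<in> ?I then inv_into ?I (enum R) (g i) else i) ` {g \<in> ?G. g ` ?I = R} \<subseteq> {\<pi>. \<pi> permutes ?I}"
      proof
        fix \<pi> assume "\<pi> \<in> (\<lambda>g i. if i \<in> ?I then inv_into ?I (enum R) (g i) else i) ` {g \<in> ?G. g ` ?I = R}"
        then obtain g where g: "bij_betw g ?I R"
          and \<pi>: "\<pi> = (\<lambda>i. if i \<in> ?I then inv_into ?I (enum R) (g i) else i)" by (auto simp: bij_betw_def)
        have "bij_betw (inv_into ?I (enum R) \<circ> g) ?I ?I"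
          using g bij_betw_inv_into[OF bij] by (rule bij_betw_trans)
        then have "bij_betw \<pi> ?I ?I" by (rule bij_betw_cong[THEN iffD1, rotated]) (auto simp: \<pi>)
        then show "\<pi> \<in> {\<pi>. \<pi> permutes ?I}" by (auto intro!: bij_imp_permutes simp: \<pi>)
      qed
    qed
    then have "sum ?h {g \<in> ?G. g ` ?I = R} = (\<Sum>\<pi> | \<pi> permutes ?I. ?h (?r \<pi>))"
      by (rule sum.reindex_bij_betw[symmetric])
    also have "\<dots> = (\<Sum>\<pi> | \<pi> permutes ?I. signof \<pi> * (\<Prod>i\<in>?I. a i (enum R (\<pi> i))) * det (?B (enum R)))"
    proof (rule sum.cong[OF refl])
      fix \<pi> assume "\<pi> \<in> {\<pi>. \<pi> permutes ?I}"
      then have \<pi>: "\<pi> permutes ?I" by simp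
      have "?B (?r \<pi>) = mat k k (\<lambda>(i, l). ?B (enum R) $$ (\<pi> i, l))"
        using permutes_in_image[OF \<pi>] by (intro eq_matI) auto
      then have "det (?B (?r \<pi>)) = signof \<pi> * det (?B (enum R))"
        using det_permute_rows[OF _ \<pi>, of "?B (enum R)"] by simp
      then show "?h (?r \<pi>) = signof \<pi> * (\<Prod>i\<in>?I. a i (enum R (\<pi> i))) * det (?B (enum R))" by simp
    qed
    also have "\<dots> = det (mat k k (\<lambda>(i, l). a i (enum R l))) * det (?B (enum R))"
      unfolding sum_distrib_right[symmetric]
      by (subst det_def'[of "mat k k (\<lambda>(i, l). a i (enum R l))" k])
        (auto simp: permutes_in_image intro!: sum.cong prod.cong arg_cong2[of _ _ _ _ "(*)"])
    finally show "sum ?h {g \<in> ?G. g ` ?I = R} = det (mat k k (\<lambda>(i, l). a i (enum R l))) * det (?B (enum R))" .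
  qed
  finally show ?thesis .
qed

definition minor :: "nat \<Rightarrow> complex mat \<Rightarrow> nat set \<Rightarrow> nat set \<Rightarrow> complex" where
  "minor k A S T = det (mat k k (\<lambda>(a, b). A $$ (enum S a, enum T b)))"

abbreviation cdim :: "nat \<Rightarrow> nat \<Rightarrow> nat" where
  "cdim n k \<equiv> length (ksubsets n k)"

text \<open>The matrix of the \<open>k\<close>-th exterior power of \<open>A\<close>.\<close>

definition compound :: "nat \<Rightarrow> nat \<Rightarrow> complex mat \<Rightarrow> complex mat" where
  "compound n k A = mat (cdim n k) (cdim n k) (\<lambda>(i, j). minor k A (ksubsets n k ! i) (ksubsets n k ! j))"

lemma compound_carrier: "compound n k A \<in> carrier_mat (cdim n k) (cdim n k)"
  by (simp add: compound_def)

lemma dim_compound [simp]: "dim_row (compound n k A) = cdim n k" "dim_col (compound n k A) = cdim n k"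
  by (simp_all add: compound_def)

lemma ksubsets_nth:
  assumes "i < cdim n k"
  shows "ksubsets n k ! i \<subseteq> {..<n}" "card (ksubsets n k ! i) = k"
  using nth_mem[OF assms] unfolding ksubsets(2) by auto

lemma minor_mult:
  assumes "A \<in> carrier_mat n n" "B \<in> carrier_mat n n"
    and "S \<subseteq> {..<n}" "card S = k" "T \<subseteq> {..<n}" "card T = k"
  shows "minor k (A * B) S T = (\<Sum>R | R \<subseteq> {..<n} \<and> card R = k. minor k A S R * minor k B R T)"
proof -
  have "mat k k (\<lambda>(a, b). (A * B) $$ (enum S a, enum T b))
      = mat k k (\<lambda>(a, b). \<Sum>j<n. A $$ (enum S a, j) * B $$ (j, enum T b))"
    using assms enum_less[OF assms(3,4)] enum_less[OF assms(5,6)]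
    by (intro eq_matI) (auto simp: scalar_prod_def lessThan_atLeast0 intro!: sum.cong)
  then show ?thesis unfolding minor_def by (simp only: cauchy_binet)
qed

lemma compound_mult:
  assumes "A \<in> carrier_mat n n" "B \<in> carrier_mat n n"
  shows "compound n k (A * B) = compound n k A * compound n k B"
proof (rule eq_matI)
  fix i j assume "i < dim_row (compound n k A * compound n k B)" "j < dim_col (compound n k A * compound n k B)"
  then have ij: "i < cdim n k" "j < cdim n k" by auto
  let ?L = "ksubsets n k"
  have "compound n k (A * B) $$ (i, j) = (\<Sum>R\<in>set ?L. minor k A (?L ! i) R * minor k B R (?L ! j))"
    using minor_mult[OF assms ksubsets_nth[OF ij(1)] ksubsets_nth[OF ij(2)]] ij
    by (simp add: compound_def ksubsets(2))
  also have "\<dots> = (\<Sum>l<cdim n k. minor k A (?L ! i) (?L ! l) * minor k B (?L ! l) (?L ! j))"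
    by (rule sum.reindex_bij_betw[symmetric, OF bij_betw_nth[OF ksubsets(1) refl refl]])
  also have "\<dots> = (compound n k A * compound n k B) $$ (i, j)"
    using ij by (auto simp: compound_def scalar_prod_def lessThan_atLeast0 intro!: sum.cong)
  finally show "compound n k (A * B) $$ (i, j) = (compound n k A * compound n k B) $$ (i, j)" .
qed auto

lemma compound_adjoint:
  assumes "A \<in> carrier_mat n n"
  shows "compound n k (A\<^sup>\<dagger>) = (compound n k A)\<^sup>\<dagger>"
proof (rule eq_matI)
  fix i j assume "i < dim_row ((compound n k A)\<^sup>\<dagger>)" "j < dim_col ((compound n k A)\<^sup>\<dagger>)"
  then have ij: "i < cdim n k" "j < cdim n k" by auto
  let ?S = "ksubsets n k ! i" and ?T = "ksubsets n k ! j"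
  interpret cnj: comm_ring_hom cnj by unfold_locales auto
  let ?M = "mat k k (\<lambda>(a, b). A $$ (enum ?T a, enum ?S b))"
  have "mat k k (\<lambda>(a, b). A\<^sup>\<dagger> $$ (enum ?S a, enum ?T b)) = transpose_mat (map_mat cnj ?M)"
    using assms enum_less[OF ksubsets_nth[OF ij(1)]] enum_less[OF ksubsets_nth[OF ij(2)]]
    by (intro eq_matI) auto
  then have "minor k (A\<^sup>\<dagger>) ?S ?T = det (map_mat cnj ?M)"
    unfolding minor_def using det_transpose[of "map_mat cnj ?M" k] by simp
  also have "\<dots> = cnj (minor k A ?T ?S)" unfolding minor_def by (rule cnj.hom_det)
  finally show "compound n k (A\<^sup>\<dagger>) $$ (i, j) = (compound n k A)\<^sup>\<dagger> $$ (i, j)"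
    using ij by (simp add: compound_def)
qed auto

lemma det_real_diag: "det (real_diag n d) = of_real (\<Prod>i\<in>{0..<n}. d i)"
proof -
  have "det (real_diag n d) = prod_list (diag_mat (real_diag n d))"
    by (rule det_upper_triangular[OF _ real_diag_carrier]) auto
  also have "\<dots> = (\<Prod>i\<in>{0..<n}. real_diag n d $$ (i, i))"
    by (simp only: diag_mat_def dim_real_diag prod.distinct_set_conv_list[OF distinct_upt, symmetric] set_upt)
  finally show ?thesis by simp
qed

text \<open>For \<open>S \<noteq> T\<close> of the same size some \<open>s \<in> S\<close> is not in \<open>T\<close>, and the row of \<open>s\<close> in this minor is zero.\<close>

lemma compound_real_diag:
  "compound n k (real_diag n d) = real_diag (cdim n k) (\<lambda>i. \<Prod>j\<in>ksubsets n k ! i. d j)"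
proof (rule eq_matI)
  fix i j assume "i < dim_row (real_diag (cdim n k) (\<lambda>i. \<Prod>j\<in>ksubsets n k ! i. d j))"
    "j < dim_col (real_diag (cdim n k) (\<lambda>i. \<Prod>j\<in>ksubsets n k ! i. d j))"
  then have ij: "i < cdim n k" "j < cdim n k" by auto
  let ?S = "ksubsets n k ! i" and ?T = "ksubsets n k ! j"
  note S = ksubsets_nth[OF ij(1)] and T = ksubsets_nth[OF ij(2)]
  note bS = bij_betw_enum[OF S] and bT = bij_betw_enum[OF T]
  have "minor k (real_diag n d) ?S ?T = (if i = j then of_real (\<Prod>j\<in>?S. d j) else 0)"
  proof (cases "i = j")
    case True
    have "mat k k (\<lambda>(a, b). real_diag n d $$ (enum ?S a, enum ?T b)) = real_diag k (\<lambda>a. d (enum ?S a))"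
      using enum_less[OF S] bij_betw_imp_inj_on[OF bS]
      unfolding True[symmetric] by (intro eq_matI) (auto simp: inj_on_eq_iff)
    then have "minor k (real_diag n d) ?S ?T = det (real_diag k (\<lambda>a. d (enum ?S a)))"
      by (simp add: minor_def)
    also have "\<dots> = of_real (\<Prod>a\<in>{0..<k}. d (enum ?S a))" by (rule det_real_diag)
    also have "(\<Prod>a\<in>{0..<k}. d (enum ?S a)) = (\<Prod>j\<in>?S. d j)"
      by (rule prod.reindex_bij_betw[OF bS])
    finally show ?thesis using True by simp
  next
    case False
    then have "?S \<noteq> ?T" using ksubsets(1) ij by (simp add: nth_eq_iff_index_eq)
    moreover have "finite ?S" "finite ?T" using S(1) T(1) finite_subset by blast+
    ultimately have "\<not> ?S \<subseteq> ?T" using S(2) T(2) card_subset_eq by metis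
    then obtain s where s: "s \<in> ?S" "s \<notin> ?T" by blast
    from s(1) have "s \<in> enum ?S ` {0..<k}" by (subst bij_betw_imp_surj_on[OF bS])
    then obtain a where a: "a < k" "enum ?S a \<notin> ?T" using s(2) by auto
    have zero: "real_diag n d $$ (enum ?S a, enum ?T b) = 0" if "b < k" for b
    proof -
      have "enum ?T b \<in> ?T" by (rule bspec[OF bij_betwE[OF bT]]) (use that in simp)
      then have "enum ?S a \<noteq> enum ?T b" using a(2) by force
      then show ?thesis using a that enum_less[OF S] enum_less[OF T] by simp
    qed
    have "minor k (real_diag n d) ?S ?T = 0" unfolding minor_def
    proof (subst det_def'[of _ k], simp, intro sum.neutral ballI)
      fix \<sigma> assume "\<sigma> \<in> {\<sigma>. \<sigma> permutes {0..<k}}"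
      then have "\<sigma> a < k" using a permutes_in_image[of \<sigma> "{0..<k}" a] by simp
      then have "(\<Prod>i = 0..<k. mat k k (\<lambda>(a, b). real_diag n d $$ (enum ?S a, enum ?T b)) $$ (i, \<sigma> i)) = 0"
        using a zero by (intro prod_zero) (auto intro!: bexI[of _ a])
      then show "signof \<sigma> * (\<Prod>i = 0..<k. mat k k (\<lambda>(a, b). real_diag n d $$ (enum ?S a, enum ?T b)) $$ (i, \<sigma> i)) = 0"
        by simp
    qed
    then show ?thesis using False by simp
  qed
  then show "compound n k (real_diag n d) $$ (i, j) = real_diag (cdim n k) (\<lambda>i. \<Prod>j\<in>ksubsets n k ! i. d j) $$ (i, j)"
    using ij by (simp add: compound_def)
qed auto

lemma compound_one: "compound n k (1\<^sub>m n) = 1\<^sub>m (cdim n k)"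
proof -
  have "1\<^sub>m n = real_diag n (\<lambda>_. 1)" by (rule eq_matI) auto
  then have "compound n k (1\<^sub>m n) = real_diag (cdim n k) (\<lambda>_. 1)" by (simp add: compound_real_diag)
  also have "\<dots> = 1\<^sub>m (cdim n k)" by (rule eq_matI) auto
  finally show ?thesis .
qed

lemma compound_unitary:
  assumes "U \<in> unitary_mats n" shows "compound n k U \<in> unitary_mats (cdim n k)"
  using unitaryD(1,4)[OF assms] compound_mult[OF mat_adjoint_carrier[OF unitaryD(1)[OF assms]] unitaryD(1)[OF assms], of k]
  by (simp add: unitary_mats_def compound_carrier compound_adjoint compound_one)

lemma compound_conj_diag:
  assumes "U \<in> unitary_mats n"
  shows "compound n k (U * real_diag n d * U\<^sup>\<dagger>) =
    compound n k U * real_diag (cdim n k) (\<lambda>i. \<Prod>j\<in>ksubsets n k ! i. d j) * (compound n k U)\<^sup>\<dagger>"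
  using unitaryD(1)[OF assms]
  by (simp add: compound_mult[of _ n] mult_carrier_mat[of _ n n _ n] real_diag_carrier mat_adjoint_carrier
      compound_adjoint compound_real_diag)

lemma compound_psd: "X \<in> psd_mats n \<Longrightarrow> compound n k X \<in> psd_mats (cdim n k)"
  by (elim psd_diagonalization) (auto simp: compound_conj_diag intro!: psd_conj_diag compound_unitary prod_nonneg)

lemma compound_pd: "X \<in> pd_mats n \<Longrightarrow> compound n k X \<in> pd_mats (cdim n k)"
  by (elim pd_diagonalization) (auto simp: compound_conj_diag intro!: pd_conj_diag compound_unitary prod_pos)

text \<open>A diagonalization of \<open>X\<close> induces one of the compound matrix, whose eigenvalues are products of
  eigenvalues of \<open>X\<close>; powers commute with such products.\<close>

lemma compound_powr:
  assumes "X \<in> psd_mats n"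
  shows "compound n k (X \<^bold>^ p) = (compound n k X) \<^bold>^ p"
proof -
  obtain U d where U: "U \<in> unitary_mats n" and d: "\<forall>i. 0 \<le> d i" and X: "X = U * real_diag n d * U\<^sup>\<dagger>"
    using psd_diagonalization[OF assms] .
  have "(\<Prod>j\<in>S. d j) powr p = (\<Prod>j\<in>S. d j powr p)" for S
    using d by (induction S rule: infinite_finite_induct) (auto simp: powr_mult prod_nonneg)
  then show ?thesis
    unfolding X mat_powr_eq[OF U] compound_conj_diag[OF U] mat_powr_eq[OF compound_unitary[OF U]] by simp
qed

lemma compound_P_mat:
  assumes A: "A \<in> psd_mats n" and B: "B \<in> pd_mats n" and r: "r > 0"
  shows "compound n k (P_mat \<alpha> r A B) = P_mat \<alpha> r (compound n k A) (compound n k B)"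
proof -
  note B' = pd_imp_psd[OF B]
  note Ap = psd_matsD(1)[OF psd_powr[OF A]] and Bp = psd_matsD(1)[OF psd_powr[OF B']]
  note psd = P_mat_psd_form[OF A B r]
  have sandwich: "compound n k (Z * X * Z) = compound n k Z * compound n k X * compound n k Z"
    if "Z \<in> carrier_mat n n" "X \<in> carrier_mat n n" for Z X
    using that by (simp add: compound_mult[of _ n] mult_carrier_mat[of _ n n _ n] mat_assoc)
  show ?thesis
    unfolding P_mat_def compound_powr[OF psd(3)] sandwich[OF Bp psd_matsD(1)[OF psd_powr[OF psd(1)]]]
      compound_powr[OF psd(1)] sandwich[OF Bp Ap] compound_powr[OF A] compound_powr[OF B'] ..
qed

section \<open>Products of eigenvalues\<close>

lemma eigvals_desc_psd:
  assumes X: "X \<in> psd_mats n"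
  shows "\<exists>U \<in> unitary_mats n. X = U * real_diag n (\<lambda>i. eigvals_desc X ! i) * U\<^sup>\<dagger>"
    "\<And>i. i < n \<Longrightarrow> 0 \<le> eigvals_desc X ! i"
    "\<And>i j. i \<le> j \<Longrightarrow> j < n \<Longrightarrow> eigvals_desc X ! j \<le> eigvals_desc X ! i"
proof -
  note Xc = psd_matsD(1,4)[OF X]
  obtain as where as: "char_poly X = (\<Prod>a\<leftarrow>as. [:- a, 1:])" using char_poly_factorized[OF Xc(1)] by blast
  note sp = spectral_theorem[OF Xc as]
  have "proots (char_poly X) = mset as"
  proof -
    have "proots (\<Prod>a\<leftarrow>as. [:- a, 1:]) = mset as"
    proof (induction as)
      case (Cons a as)
      have "(\<Prod>a\<leftarrow>as. [:- a, 1:]) \<noteq> 0" by (auto simp: prod_list_zero_iff)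
      then show ?case
        using Cons proots_mult[of "[:- a, 1:]" "\<Prod>a\<leftarrow>as. [:- a, 1:]"] proots_linear_factor[of "- a"]
        by (simp del: mult_pCons_left)
    qed simp
    then show ?thesis unfolding as .
  qed
  then have es: "eigvals_desc X = rev (sort (map Re as))"
    unfolding eigvals_desc_def by (simp flip: mset_map)
  have len: "length (eigvals_desc X) = n" using es sp(3) by simp
  have "mset (map complex_of_real (eigvals_desc X)) = mset (map (\<lambda>a. of_real (Re a)) as)"
    unfolding es by (simp add: image_mset.compositionality comp_def)
  also have "map (\<lambda>a. of_real (Re a)) as = as"
    by (rule map_idI) (use sp(2) in \<open>auto simp: complex_eq_iff\<close>)
  finally have ms: "mset (map complex_of_real (eigvals_desc X)) = mset as" .
  have "char_poly X = prod_mset (image_mset (\<lambda>a. [:- a, 1:]) (mset as))"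
    unfolding as by (simp add: prod_mset_prod_list flip: mset_map)
  also have "\<dots> = (\<Prod>a\<leftarrow>map complex_of_real (eigvals_desc X). [:- a, 1:])"
    unfolding ms[symmetric] by (simp only: mset_map[symmetric] prod_mset_prod_list)
  finally have "\<exists>U \<in> unitary_mats n. X = U * real_diag n (\<lambda>i. Re (map complex_of_real (eigvals_desc X) ! i)) * U\<^sup>\<dagger>"
    by (rule spectral_theorem(1)[OF Xc])
  also have "real_diag n (\<lambda>i. Re (map complex_of_real (eigvals_desc X) ! i)) = real_diag n (\<lambda>i. eigvals_desc X ! i)"
    by (rule real_diag_cong) (simp add: len)
  finally show *: "\<exists>U \<in> unitary_mats n. X = U * real_diag n (\<lambda>i. eigvals_desc X ! i) * U\<^sup>\<dagger>" .
  show "0 \<le> eigvals_desc X ! i" if "i < n" for i using * psd_conj_diag_nonneg that X by metis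
  show "eigvals_desc X ! j \<le> eigvals_desc X ! i" if "i \<le> j" "j < n" for i j
    using sorted_rev_nth_mono[of "eigvals_desc X" i j] that len by (simp add: es)
qed

text \<open>The eigenvalues of the compound matrix are the products over all \<open>k\<close>-subsets, and the largest
  one belongs to the first \<open>k\<close> indices: the \<open>a\<close>-th smallest element of any set of indices is at
  least \<open>a\<close>, counting from \<open>0\<close>.\<close>

lemma opnorm_compound_iff:
  assumes X: "X \<in> psd_mats n" and k: "k \<le> n" and c: "0 \<le> c"
  shows "opnorm_le (cdim n k) (compound n k X) c \<longleftrightarrow> (\<Prod>i<k. eigvals_desc X ! i) \<le> c"
proof -
  let ?e = "\<lambda>i. eigvals_desc X ! i"
  note e = eigvals_desc_psd[OF X]
  obtain U where U: "U \<in> unitary_mats n" and XU: "X = U * real_diag n ?e * U\<^sup>\<dagger>" using e(1) by blast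
  have nonneg: "0 \<le> (\<Prod>j\<in>S. ?e j)" if "S \<subseteq> {..<n}" for S
    using that e(2) by (intro prod_nonneg) auto
  have max: "(\<Prod>j\<in>S. ?e j) \<le> (\<Prod>i<k. ?e i)" if S: "S \<subseteq> {..<n}" "card S = k" for S
  proof -
    have fin: "finite S" using S(1) finite_subset by blast
    have "(\<Prod>j\<in>S. ?e j) = (\<Prod>a\<in>{0..<k}. ?e (enum S a))"
      by (rule prod.reindex_bij_betw[symmetric, OF bij_betw_enum[OF S]])
    also have "\<dots> \<le> (\<Prod>a\<in>{0..<k}. ?e a)"
    proof (rule prod_mono)
      fix a assume "a \<in> {0..<k}"
      then have a: "a < k" by simp
      have "a \<le> enum S a"
        using sorted_wrt_less_idx[OF strict_sorted_list_of_set[of S], of a] a S fin by simp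
      then show "0 \<le> ?e (enum S a) \<and> ?e (enum S a) \<le> ?e a"
        using e(2,3) enum_less[OF S a] by simp
    qed
    finally show ?thesis by (simp add: lessThan_atLeast0)
  qed
  have "compound n k X = compound n k U * real_diag (cdim n k) (\<lambda>i. \<Prod>j\<in>ksubsets n k ! i. ?e j) * (compound n k U)\<^sup>\<dagger>"
    by (subst XU) (rule compound_conj_diag[OF U])
  then have "opnorm_le (cdim n k) (compound n k X) c \<longleftrightarrow>
      (\<forall>i<cdim n k. \<bar>\<Prod>j\<in>ksubsets n k ! i. ?e j\<bar> \<le> c)"
    using opnorm_le_conj_diag[OF compound_unitary[OF U] c] by simp
  also have "\<dots> \<longleftrightarrow> (\<forall>S \<in> set (ksubsets n k). \<bar>\<Prod>j\<in>S. ?e j\<bar> \<le> c)"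
    by (simp add: all_set_conv_all_nth)
  also have "\<dots> \<longleftrightarrow> (\<forall>S \<in> set (ksubsets n k). (\<Prod>j\<in>S. ?e j) \<le> c)"
    using nonneg by (auto simp: ksubsets(2))
  also have "\<dots> \<longleftrightarrow> (\<Prod>i<k. ?e i) \<le> c"
  proof
    assume *: "\<forall>S \<in> set (ksubsets n k). (\<Prod>j\<in>S. ?e j) \<le> c"
    have "{..<k} \<in> set (ksubsets n k)" using k by (simp add: ksubsets(2))
    then show "(\<Prod>i<k. ?e i) \<le> c" using * by blast
  next
    assume "(\<Prod>i<k. ?e i) \<le> c"
    then show "\<forall>S \<in> set (ksubsets n k). (\<Prod>j\<in>S. ?e j) \<le> c"
      using max order_trans unfolding ksubsets(2) by blast
  qed
  finally show ?thesis .
qed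

lemma det_conj_diag:
  assumes U: "U \<in> unitary_mats n"
  shows "det (U * real_diag n d * U\<^sup>\<dagger>) = of_real (\<Prod>i<n. d i)"
proof -
  note Uc = unitaryD(1)[OF U] and Ua = mat_adjoint_carrier[OF unitaryD(1)[OF U]]
  have "det (U * real_diag n d * U\<^sup>\<dagger>) = det (real_diag n d) * (det U * det (U\<^sup>\<dagger>))"
    using Uc Ua by (simp add: det_mult[of _ n] mult_carrier_mat[of _ n n _ n] real_diag_carrier)
  also have "det U * det (U\<^sup>\<dagger>) = 1"
    using det_mult[OF Uc Ua] unfolding unitaryD(5)[OF U] by simp
  finally show ?thesis by (simp add: det_real_diag lessThan_atLeast0)
qed

lemma det_psd_powr:
  assumes "X \<in> psd_mats n"
  shows "det (X \<^bold>^ p) = of_real (Re (det X) powr p)"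
proof -
  obtain U d where U: "U \<in> unitary_mats n" and d: "\<forall>i. 0 \<le> d i" and X: "X = U * real_diag n d * U\<^sup>\<dagger>"
    using psd_diagonalization[OF assms] .
  have "(\<Prod>j\<in>S. d j powr p) = (\<Prod>j\<in>S. d j) powr p" for S
    using d by (induction S rule: infinite_finite_induct) (auto simp: powr_mult prod_nonneg)
  then show ?thesis unfolding X mat_powr_eq[OF U] det_conj_diag[OF U] by (simp del: of_real_prod)
qed

text \<open>The exponents of \<open>det A\<close> and \<open>det B\<close> are independent of \<open>r\<close>; this is the equality for \<open>k = n\<close>.\<close>

lemma det_P_mat:
  assumes A: "A \<in> psd_mats n" and B: "B \<in> pd_mats n" and r: "r > 0"
  shows "det (P_mat \<alpha> r A B) = of_real (Re (det A) powr \<alpha> * Re (det B) powr (1 - \<alpha>))"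
proof -
  note B' = pd_imp_psd[OF B]
  note Ap = psd_matsD(1)[OF psd_powr[OF A]] and Bp = psd_matsD(1)[OF psd_powr[OF B']]
  define N where "N = B \<^bold>^ (- (1 / (2 * r))) * A \<^bold>^ (1 / r) * B \<^bold>^ (- (1 / (2 * r)))"
  define Q where "Q = B \<^bold>^ (1 / (2 * r)) * N \<^bold>^ \<alpha> * B \<^bold>^ (1 / (2 * r))"
  have N: "N \<in> psd_mats n" and Q: "Q \<in> psd_mats n"
    using P_mat_psd_form(1,3)[OF A B r] by (auto simp: N_def Q_def)
  define a b where "a = Re (det A)" and "b = Re (det B)"
  have sandwich: "det (Z * X * Z) = det X * det Z ^ 2"
    if "Z \<in> carrier_mat n n" "X \<in> carrier_mat n n" for Z X :: "complex mat"
    using that by (simp add: det_mult[of _ n] mult_carrier_mat[of _ n n _ n] power2_eq_square)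
  have sq: "(b powr (x / (2 * r)))\<^sup>2 = b powr (x / r)" for x
    by (simp add: power2_eq_square flip: powr_add)
  have "det N = of_real (a powr (1 / r) * b powr (- 1 / r))"
    unfolding N_def sandwich[OF Bp Ap] det_psd_powr[OF A] det_psd_powr[OF B'] a_def[symmetric] b_def[symmetric]
    using sq[of "- 1"] by (simp flip: of_real_power)
  then have "det Q = of_real ((a powr (1 / r) * b powr (- 1 / r)) powr \<alpha> * b powr (1 / r))"
    unfolding Q_def sandwich[OF Bp psd_matsD(1)[OF psd_powr[OF N]]] det_psd_powr[OF N] det_psd_powr[OF B'] b_def[symmetric]
    using sq[of 1] by (simp flip: of_real_power)
  then have "det (Q \<^bold>^ r) = of_real (((a powr (1 / r) * b powr (- 1 / r)) powr \<alpha> * b powr (1 / r)) powr r)"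
    unfolding det_psd_powr[OF Q] by simp
  also have "((a powr (1 / r) * b powr (- 1 / r)) powr \<alpha> * b powr (1 / r)) powr r
      = a powr \<alpha> * (b powr (- \<alpha>) * b powr 1)"
    unfolding powr_mult powr_powr using r by simp
  also have "b powr (- \<alpha>) * b powr 1 = b powr (1 - \<alpha>)" by (simp only: powr_add[symmetric]) simp
  finally show ?thesis by (simp add: P_mat_def Q_def N_def a_def b_def)
qed

lemma prod_eigvals_desc:
  assumes X: "X \<in> psd_mats n"
  shows "(\<Prod>i<n. eigvals_desc X ! i) = Re (det X)"
proof -
  obtain U where U: "U \<in> unitary_mats n" and XU: "X = U * real_diag n (\<lambda>i. eigvals_desc X ! i) * U\<^sup>\<dagger>"
    using eigvals_desc_psd(1)[OF X] by blast
  have "det X = of_real (\<Prod>i<n. eigvals_desc X ! i)" by (subst XU) (rule det_conj_diag[OF U])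
  then show ?thesis by (simp del: of_real_prod)
qed

section \<open>Log-majorization\<close>

theorem corollary5p2:
  fixes \<alpha> r r' :: real and n :: nat and A B :: "complex mat"
  assumes "\<alpha> \<ge> 2"
    and "A \<in> psd_mats n"
    and "B \<in> pd_mats n"
    and "r > 0" and "r' > 0"
  shows "(r' \<le> \<alpha> / (2 * (\<alpha> - 1)) * r \<longrightarrow> log_majorized n (P_mat \<alpha> r A B) (P_mat \<alpha> r' A B)) \<and>
         (r' \<le> r / 2 \<longrightarrow> log_majorized n (P_mat \<alpha> r A B) (P_mat \<alpha> r' A B))"
proof -
  note A = assms(2) and B = assms(3)
  have main: "log_majorized n (P_mat \<alpha> r A B) (P_mat \<alpha> r' A B)" if rr: "r' \<le> \<alpha> / (2 * (\<alpha> - 1)) * r"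
    unfolding log_majorized_def
  proof (intro conjI ballI)
    note X = P_mat_psd[OF A B assms(4), of \<alpha>] and Y = P_mat_psd[OF A B assms(5), of \<alpha>]
    show "(\<Prod>i<n. eigvals_desc (P_mat \<alpha> r A B) ! i) = (\<Prod>i<n. eigvals_desc (P_mat \<alpha> r' A B) ! i)"
      unfolding prod_eigvals_desc[OF X] prod_eigvals_desc[OF Y] det_P_mat[OF A B assms(4)] det_P_mat[OF A B assms(5)] ..
    fix k assume "k \<in> {1..n}"
    then have k: "k \<le> n" by simp
    let ?x = "\<Prod>i<k. eigvals_desc (P_mat \<alpha> r A B) ! i" and ?y = "\<Prod>i<k. eigvals_desc (P_mat \<alpha> r' A B) ! i"
    have y: "0 \<le> ?y" using eigvals_desc_psd(2)[OF Y] k by (intro prod_nonneg) auto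
    \<comment> \<open>\<open>?y\<close> may be \<open>0\<close>, but the norm inequality is for positive bounds\<close>
    show "?x \<le> ?y"
    proof (rule field_le_epsilon)
      fix \<epsilon> :: real assume \<epsilon>: "0 < \<epsilon>"
      then have c: "0 < ?y + \<epsilon>" "0 \<le> ?y + \<epsilon>" using y by auto
      have "opnorm_le (cdim n k) (compound n k (P_mat \<alpha> r' A B)) (?y + \<epsilon>)"
        using opnorm_compound_iff[OF Y k c(2)] \<epsilon> by simp
      then have "opnorm_le (cdim n k) (compound n k (P_mat \<alpha> r A B)) (?y + \<epsilon>)"
        unfolding compound_P_mat[OF A B assms(4)] compound_P_mat[OF A B assms(5)]
        by (rule P_mat_opnorm_mono[OF compound_psd[OF A] compound_pd[OF B] assms(1,4,5) rr c(1)])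
      then show "?x \<le> ?y + \<epsilon>" using opnorm_compound_iff[OF X k c(2)] by simp
    qed
  qed
  have "r / 2 \<le> \<alpha> / (2 * (\<alpha> - 1)) * r" using assms(1,4) by (simp add: field_simps)
  then show ?thesis using main order.trans by blast
qed

end
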